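(* Let $N\ge 1$ be an integer and $\hat t>0$. For $k=1,\dots,N$ let $A_k\in\mathbb{R}^{d_k\times d_k}$, $B_k\in\mathbb{R}^{d_k\times m_k}$, let $\mathbb{U}^{(k)}\subset\mathbb{R}^{m_k}$ be a compact set containing $0$, let $\hat Q_k\in\mathbb{R}^{d_k\times d_k}$ be symmetric and non-negative definite, let $\lambda_k>0$, and let $\bar x^k,\hat x^k\in\mathbb{R}^{d_k}$. Put $d=\sum_k d_k$, $m=\sum_k m_k$, $A=\operatorname{blkdiag}(A_1,\dots,A_N)$, $B=\operatorname{blkdiag}(B_1,\dots,B_N)$, $\hat Q=\operatorname{blkdiag}(\hat Q_1,\dots,\hat Q_N)$, $\bar x=(\bar x^1,\dots,\bar x^N)$, $\hat x=(\hat x^1,\dots,\hat x^N)\in\mathbb{R}^d$, $\lambda_k'=\sum_{\ell\ne k}\lambda_\ell$, and $$\mathbb{U}_{\mathrm{M}}=\bigcup_{k=1}^N \{0\}\times\cdots\times\mathbb{U}^{(k)}\times\cdots\times\{0\}\subset\mathbb{R}^m\quad(\mathbb{U}^{(k)}\text{ in the }k\text{-th factor}).$$ Consider the optimal control problem $$\text{minimize over }u:\quad-\int_0^{\hat t}\sum_{k=1}^N\lambda_k\mathsf 1_{\{0\}}(u^k(t))\,dt+\tfrac12\bigl\langle x(\hat t)-\hat x,\ \hat Q(x(\hat t)-\hat x)\bigr\rangle$$ subject to $\dot x(t)=Ax(t)+Bu(t)$ for a.e. $t\in[0,\hat t]$, $x(0)=\bar x$, and $u=(u^1,\dots,u^N):[0,\hat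 t]\to\mathbb{U}_{\mathrm{M}}$ measurable. If $[0,\hat t]\ni t\mapsto(x_*(t),u_*(t))\in\mathbb{R}^d\times\mathbb{U}_{\mathrm{M}}$ is a local minimizer of this problem, then there exist an absolutely continuous map $p=(p^1,\dots,p^N):[0,\hat t]\to\mathbb{R}^{d_1}\times\cdots\times\mathbb{R}^{d_N}$ and a measurable map $\sigma:[0,\hat t]\to\{1,\dots,N\}$ such that $x_*(0)=\bar x$, $p(\hat t)=-\hat Q(x_*(\hat t)-\hat x)$ and, for a.e. $t\in[0,\hat t]$: $\bullet$ $\dot x_*(t)=Ax_*(t)+Bu_*(t)$ and $\dot p(t)=-A^\top p(t)$; $\bullet$ for each $k=1,\dots,N$, if $k\ne\sigma(t)$ then $u_*^k(t)=0$, while if $k=\sigma(t)$ then $$u_*^k(t)\in\begin{cases}\arg\max_{v\in\mathbb{U}^{(k)}}\langle B_k^\top p^k(t),v\rangle & \text{if }\max_{v\in\mathbb{U}^{(k)}}\langle B_k^\top p^k(t),v\rangle>\lambda_k,\\ \{0\}\cup\arg\max_{v\in\mathbb{U}^{(k)}}\langle B_k^\top p^k(t),v\rangle & \text{if }\max_{v\in\mathbb{U}^{(k)}}\langle B_k^\top p^k(t),v\rangle=\lambda_k,\\ \{0\}&\text{otherwise;}\end{cases}$$ $\bullet$ $$\sigma(t)\in\arg\max_{k\in\{1,\dots,N\}}\ \max_{v\in\mathbb{U}^{(k)}}\bigl\{\langle B_k^\top p^k(t),v\rangle+\lambda_k\mathsf 1_{\{0\}}(v)+\lambda_k'\bigr\}.$$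 Moreover, the map $$[0,\hat t]\ni t\mapsto\langle p(t),Ax_*(t)+Bu_*(t)\rangle+\sum_{k=1}^N\lambda_k\mathsf 1_{\{0\}}(u_*^k(t))\in\mathbb{R}$$ is constant a.e.
   Context: Measurability and "a.e." refer to Lebesgue measure. $\langle v,w\rangle=v^\top w$ is the standard inner product. $\mathsf 1_{\{0\}}(z)=1$ if $z=0$ and $0$ otherwise. $\operatorname{blkdiag}$ denotes the block-diagonal matrix with the listed blocks. Vectors in $\mathbb{R}^d$ and $\mathbb{R}^m$ are partitioned into $N$ blocks, with the $k$-th block in $\mathbb{R}^{d_k}$ and $\mathbb{R}^{m_k}$ respectively, and the block is indicated by a superscript $k$. An admissible state-action trajectory is a pair $(x,u)$ satisfying all constraints of the problem, where $x$ is the absolutely continuous (Carathéodory) solution of the differential equation under $u$. A local minimizer is an admissible state-action trajectory $(x_*,u_* )$ for which there is $\varepsilon>0$ such that the cost of $(x_*,u_* )$ does not exceed the cost of any admissible $(x,u)$ with $\sup_{t\in[0,\hat t]}\|x(t)-x_*(t)\|\le\varepsilon$. *)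

theory Defs
  imports "HOL-Analysis.Analysis"
begin

text \<open>
  Block structure. The coordinates of \<^term>\<open>x :: real ^ 'd\<close> are sorted into blocks by a map
  \<open>\<beta> :: 'd \<Rightarrow> 'n\<close>: coordinate \<open>i\<close> belongs to block \<open>\<beta> i\<close>. The block labels \<open>{1,...,N}\<close> are the
  elements of the finite type \<open>'n\<close>, the block dimension \<open>d\<^sub>k\<close> is the cardinality of the fibre of
  \<open>\<beta>\<close> over \<open>k\<close>, and \<open>d = (\<Sum>k. d\<^sub>k)\<close> is \<open>CARD('d)\<close>. As the \<open>d\<^sub>k\<close> may differ, the space of
  \<open>k\<close>-th blocks is represented as the coordinate subspace of \<open>real ^ 'd\<close> spanned by the coordinates
  in block \<open>k\<close>, and a matrix between two such spaces as a big matrix all of whose entries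
  outside the relevant block vanish. Inner products, norms, compactness, matrix products and
  transposes of blocks then agree with those of the ambient spaces.
\<close>

definition block_space :: "('d \<Rightarrow> 'n) \<Rightarrow> 'n \<Rightarrow> (real ^ 'd) set" where
  "block_space \<beta> k = {v. \<forall>i. \<beta> i \<noteq> k \<longrightarrow> v $ i = 0}"

definition block :: "('d \<Rightarrow> 'n) \<Rightarrow> 'n \<Rightarrow> real ^ 'd \<Rightarrow> real ^ 'd" where
  "block \<beta> k v = (\<chi> i. if \<beta> i = k then v $ i else 0)"

definition block_matrices :: "('d \<Rightarrow> 'n) \<Rightarrow> ('m \<Rightarrow> 'n) \<Rightarrow> 'n \<Rightarrow> (real ^ 'm ^ 'd) set" where
  "block_matrices \<beta> \<gamma> k = {M. \<forall>i j. \<not> (\<beta> i = k \<and> \<gamma> j = k) \<longrightarrow> M $ i $ j = 0}"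

definition blkdiag ::
  "('d \<Rightarrow> 'n) \<Rightarrow> ('m \<Rightarrow> 'n) \<Rightarrow> ('n \<Rightarrow> real ^ 'm ^ 'd) \<Rightarrow> real ^ 'm ^ 'd" where
  "blkdiag \<beta> \<gamma> M = (\<chi> i j. if \<beta> i = \<gamma> j then M (\<beta> i) $ i $ j else 0)"

text \<open>The \<open>k\<close>-th set of the union is \<open>{0} \<times> \<dots> \<times> U k \<times> \<dots> \<times> {0}\<close>.\<close>

definition U_M :: "('m \<Rightarrow> 'n) \<Rightarrow> ('n \<Rightarrow> (real ^ 'm) set) \<Rightarrow> (real ^ 'm) set" where
  "U_M \<gamma> U = (\<Union>k. {u. block \<gamma> k u \<in> U k \<and> (\<forall>l. l \<noteq> k \<longrightarrow> block \<gamma> l u = 0)})"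

text \<open>
  The usual \<open>\<epsilon>\<close>-\<open>\<delta>\<close> notion on \<open>[a, b]\<close>: a division of its own union is exactly a finite family
  of non-overlapping compact nonempty intervals.
\<close>

definition absolutely_continuous_fun ::
  "real \<Rightarrow> real \<Rightarrow> (real \<Rightarrow> 'a::real_normed_vector) \<Rightarrow> bool" where
  "absolutely_continuous_fun a b f \<longleftrightarrow>
     (\<forall>\<epsilon>>0. \<exists>\<delta>>0. \<forall>\<D>. \<D> division_of \<Union>\<D> \<and> \<Union>\<D> \<subseteq> {a..b} \<and> (\<Sum>K\<in>\<D>. Sup K - Inf K) < \<delta>
        \<longrightarrow> (\<Sum>K\<in>\<D>. norm (f (Sup K) - f (Inf K))) < \<epsilon>)"

definition admissible ::
  "real ^ 'd ^ 'd \<Rightarrow> real ^ 'm ^ 'd \<Rightarrow> (real ^ 'm) set \<Rightarrow> real \<Rightarrow> real ^ 'd \<Rightarrow>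
   (real \<Rightarrow> real ^ 'd) \<Rightarrow> (real \<Rightarrow> real ^ 'm) \<Rightarrow> bool" where
  "admissible A B V T xbar x u \<longleftrightarrow>
     u \<in> borel_measurable (lebesgue_on {0..T}) \<and>
     (\<forall>t\<in>{0..T}. u t \<in> V) \<and>
     absolutely_continuous_fun 0 T x \<and>
     x 0 = xbar \<and>
     (AE t in lebesgue_on {0..T}.
        (x has_vector_derivative (A *v x t + B *v u t)) (at t within {0..T}))"

definition cost ::
  "('m \<Rightarrow> 'n) \<Rightarrow> ('n \<Rightarrow> real) \<Rightarrow> real ^ 'd ^ 'd \<Rightarrow> real ^ 'd \<Rightarrow> real \<Rightarrow>
   (real \<Rightarrow> real ^ 'd) \<Rightarrow> (real \<Rightarrow> real ^ 'm) \<Rightarrow> real" where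
  "cost \<gamma> lam Q xhat T x u =
     - integral\<^sup>L (lebesgue_on {0..T}) (\<lambda>t. \<Sum>k\<in>UNIV. lam k * indicator {0} (block \<gamma> k (u t)))
     + 1 / 2 * ((x T - xhat) \<bullet> (Q *v (x T - xhat)))"

definition local_minimizer ::
  "real ^ 'd ^ 'd \<Rightarrow> real ^ 'm ^ 'd \<Rightarrow> (real ^ 'm) set \<Rightarrow> real \<Rightarrow> real ^ 'd \<Rightarrow>
   ((real \<Rightarrow> real ^ 'd) \<Rightarrow> (real \<Rightarrow> real ^ 'm) \<Rightarrow> real) \<Rightarrow>
   (real \<Rightarrow> real ^ 'd) \<Rightarrow> (real \<Rightarrow> real ^ 'm) \<Rightarrow> bool" where
  "local_minimizer A B V T xbar J xs us \<longleftrightarrow>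
     admissible A B V T xbar xs us \<and>
     (\<exists>\<epsilon>>0. \<forall>x u. admissible A B V T xbar x u \<and> (SUP t\<in>{0..T}. norm (x t - xs t)) \<le> \<epsilon>
        \<longrightarrow> J xs us \<le> J x u)"

definition argmax :: "('a \<Rightarrow> real) \<Rightarrow> 'a set \<Rightarrow> 'a set" where
  "argmax f S = {v. is_arg_max f (\<lambda>w. w \<in> S) v}"

text \<open>
  Maxima over compact sets are written as suprema; the following two facts show that the suprema
  in question are attained.
\<close>

lemma SUP_inner_attained:
  fixes U :: "(real ^ 'm) set"
  assumes "compact U" "0 \<in> U"
  shows "\<exists>v\<in>U. (SUP w\<in>U. b \<bullet> w) = b \<bullet> v"
proof -
  have "continuous_on U (\<lambda>w. b \<bullet> w)"
    by (intro continuous_intros)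
  then obtain v where v: "v \<in> U" "\<forall>w\<in>U. b \<bullet> w \<le> b \<bullet> v"
    using continuous_attains_sup[of U "\<lambda>w. b \<bullet> w"] assms by blast
  have "(SUP w\<in>U. b \<bullet> w) = b \<bullet> v"
    by (rule cSup_eq_maximum) (use v in auto)
  with v(1) show ?thesis by blast
qed

lemma SUP_inner_indicator_attained:
  fixes U :: "(real ^ 'm) set"
  assumes "compact U" "0 \<in> U" "l > 0"
  shows "\<exists>v\<in>U. (SUP w\<in>U. b \<bullet> w + l * indicator {0} w + c) = b \<bullet> v + l * indicator {0} v + c"
proof -
  have "continuous_on U (\<lambda>w. b \<bullet> w)"
    by (intro continuous_intros)
  then obtain z where z: "z \<in> U" "\<forall>w\<in>U. b \<bullet> w \<le> b \<bullet> z"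
    using continuous_attains_sup[of U "\<lambda>w. b \<bullet> w"] assms by blast
  let ?f = "\<lambda>w. b \<bullet> w + l * indicator {0} w + c"
  have "\<exists>v\<in>U. \<forall>w\<in>U. ?f w \<le> ?f v"
  proof (cases "b \<bullet> z \<le> l")
    case True
    have "?f w \<le> ?f 0" if "w \<in> U" for w
      using z(2) that True by (cases "w = 0") force+
    then show ?thesis using assms(2) by blast
  next
    case False
    then have "z \<noteq> 0" using assms(3) by auto
    have "?f w \<le> ?f z" if "w \<in> U" for w
      using z(2) that False \<open>z \<noteq> 0\<close> by (cases "w = 0") auto
    then show ?thesis using z(1) by blast
  qed
  then obtain v where v: "v \<in> U" "\<forall>w\<in>U. ?f w \<le> ?f v" by blast
  have "(SUP w\<in>U. ?f w) = ?f v"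
    by (rule cSup_eq_maximum) (use v in auto)
  with v(1) show ?thesis by blast
qed

end

theory Submission
  imports Defs
begin

text \<open>
  The dynamics are linear and the control enters the running cost only through the term
  \<open>L u = (\<Sum>k. \<lambda>\<^sub>k 1\<^bsub>{0}\<^esub> (u\<^sup>k))\<close>, which is bounded but discontinuous. Such an \<open>L\<close> is no obstacle to needle
  variations, because these never differentiate in the control.

  Let \<open>p\<close> solve \<open>p' = - A\<^sup>T p\<close> with \<open>p T = - Q (xs T - xhat)\<close>. Replacing \<open>us\<close> by a constant \<open>v\<close> on a short
  interval \<open>[s, t]\<close> changes the cost by the integral over \<open>[s, t]\<close> of
  \<open>(p \<bullet> B us + L us) - (p \<bullet> B v + L v)\<close>, up to \<open>O((t - s)\<^sup>2)\<close>: the linear part of the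
  terminal cost is carried back in time by \<open>p\<close> (\<open>adjoint_pairing_has_integral\<close>), and the end point moves
  by \<open>O(t - s)\<close> (\<open>needle_trajectory\<close>). Local minimality makes this integral at least
  \<open>- C (t - s)\<^sup>2\<close> on every short interval, which forces the integrand to be nonnegative almost everywhere
  (\<open>AE_nonneg_if_integral_ge_quadratic\<close>). A countable set of values \<open>v\<close>, dense at constant \<open>L\<close>, gives a
  common null set (\<open>maximum_condition\<close>).

  The control set is the union of the sets \<open>U k\<close>, on each of which the Hamiltonian
  \<open>p \<bullet> B v + L v\<close> involves only the data of block \<open>k\<close>. Reading off what it means to maximize it gives the
  description of \<open>us\<close> and \<open>\<sigma>\<close> (\<open>pointwise_maximizer_structure\<close>), where \<open>\<sigma>\<close> is the block in which \<open>us\<close> is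
  active. Finally, the maximized Hamiltonian is constant since it depends on time only through
  \<open>p\<close> and \<open>xs\<close>, along which it is stationary; \<open>hamiltonian_constant\<close> makes this rigorous without
  differentiability of the maximum.
\<close>

section \<open>Calculus on an interval with exceptional null sets\<close>

lemma AE_lebesgue_on_interval_iff:
  fixes a b :: real
  shows "(AE t in lebesgue_on {a..b}. P t) \<longleftrightarrow> (\<exists>N. negligible N \<and> (\<forall>t\<in>{a..b} - N. P t))"
proof -
  have "(AE t in lebesgue_on {a..b}. P t) \<longleftrightarrow> (AE t in lebesgue. t \<in> {a..b} \<longrightarrow> P t)"
    by (subst AE_restrict_space_iff) auto
  also have "\<dots> \<longleftrightarrow> (\<exists>N\<in>null_sets lebesgue. {t. \<not> (t \<in> {a..b} \<longrightarrow> P t)} \<subseteq> N)"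
    by (simp add: eventually_ae_filter)
  also have "\<dots> \<longleftrightarrow> (\<exists>N. negligible N \<and> (\<forall>t\<in>{a..b} - N. P t))"
    unfolding negligible_iff_null_sets by blast
  finally show ?thesis .
qed

lemma lipschitz_imp_absolutely_continuous:
  assumes "C-lipschitz_on {a..b} f"
  shows "absolutely_continuous_fun a b f"
  unfolding absolutely_continuous_fun_def
proof (intro allI impI)
  fix e :: real assume "e > 0"
  have C: "C \<ge> 0" using assms lipschitz_on_nonneg by blast
  show "\<exists>\<delta>>0. \<forall>\<D>. \<D> division_of \<Union>\<D> \<and> \<Union>\<D> \<subseteq> {a..b} \<and> (\<Sum>K\<in>\<D>. Sup K - Inf K) < \<delta>
      \<longrightarrow> (\<Sum>K\<in>\<D>. norm (f (Sup K) - f (Inf K))) < e"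
  proof (intro exI[of _ "e / (C + 1)"] conjI allI impI; (elim conjE)?)
    show "e / (C + 1) > 0" using C \<open>e > 0\<close> by simp
    fix \<D> :: "real set set"
    assume D: "\<D> division_of \<Union>\<D>" "\<Union>\<D> \<subseteq> {a..b}" "(\<Sum>K\<in>\<D>. Sup K - Inf K) < e / (C + 1)"
    have K: "Inf K \<in> {a..b} \<and> Sup K \<in> {a..b} \<and> Inf K \<le> Sup K" if "K \<in> \<D>" for K
    proof -
      obtain c d where "K = cbox c d" "K \<noteq> {}"
        using division_ofD(3,4)[OF D(1) \<open>K \<in> \<D>\<close>] by blast
      moreover have "K \<subseteq> {a..b}" using that D(2) by blast
      ultimately show ?thesis by auto
    qed
    have "(\<Sum>K\<in>\<D>. norm (f (Sup K) - f (Inf K))) \<le> (\<Sum>K\<in>\<D>. (C + 1) * (Sup K - Inf K))"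
    proof (rule sum_mono)
      fix K assume "K \<in> \<D>"
      have "norm (f (Sup K) - f (Inf K)) \<le> C * norm (Sup K - Inf K)"
        using K[OF \<open>K \<in> \<D>\<close>] by (intro lipschitz_on_normD[OF assms]) auto
      also have "\<dots> \<le> (C + 1) * (Sup K - Inf K)"
        using K[OF \<open>K \<in> \<D>\<close>] by (simp add: algebra_simps)
      finally show "norm (f (Sup K) - f (Inf K)) \<le> (C + 1) * (Sup K - Inf K)" .
    qed
    also have "\<dots> = (C + 1) * (\<Sum>K\<in>\<D>. Sup K - Inf K)"
      by (simp add: sum_distrib_left)
    also have "\<dots> < e"
      using D(3) C by (simp add: field_simps)
    finally show "(\<Sum>K\<in>\<D>. norm (f (Sup K) - f (Inf K))) < e" .
  qed
qed

lemma absolutely_continuous_funD: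
  assumes "absolutely_continuous_fun a b f" "\<epsilon> > 0"
  shows "\<exists>\<delta>>0. \<forall>\<D>. \<D> division_of \<Union>\<D> \<longrightarrow> \<Union>\<D> \<subseteq> {a..b} \<longrightarrow>
      (\<Sum>K\<in>\<D>. Sup K - Inf K) < \<delta> \<longrightarrow> (\<Sum>K\<in>\<D>. norm (f (Sup K) - f (Inf K))) < \<epsilon>"
  using assms(1)[unfolded absolutely_continuous_fun_def, rule_format, OF assms(2)]
  by (simp only: imp_conjL)

lemma absolutely_continuous_subinterval:
  assumes f: "absolutely_continuous_fun a b f" and sub: "{c..d} \<subseteq> {a..b}"
  shows "absolutely_continuous_fun c d f"
  unfolding absolutely_continuous_fun_def
proof (intro allI impI)
  fix e :: real assume "e > 0"
  obtain \<delta> where "\<delta> > 0" and \<delta>: "\<forall>\<D>. \<D> division_of \<Union>\<D> \<longrightarrow> \<Union>\<D> \<subseteq> {a..b} \<longrightarrow>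
      (\<Sum>K\<in>\<D>. Sup K - Inf K) < \<delta> \<longrightarrow> (\<Sum>K\<in>\<D>. norm (f (Sup K) - f (Inf K))) < e"
    using absolutely_continuous_funD[OF f \<open>e > 0\<close>] by blast
  show "\<exists>\<delta>>0. \<forall>\<D>. \<D> division_of \<Union>\<D> \<and> \<Union>\<D> \<subseteq> {c..d} \<and> (\<Sum>K\<in>\<D>. Sup K - Inf K) < \<delta>
      \<longrightarrow> (\<Sum>K\<in>\<D>. norm (f (Sup K) - f (Inf K))) < e"
  proof (intro exI[of _ \<delta>] conjI allI impI \<open>\<delta> > 0\<close>, elim conjE)
    fix \<D> :: "real set set"
    assume "\<D> division_of \<Union>\<D>" "\<Union>\<D> \<subseteq> {c..d}" "(\<Sum>K\<in>\<D>. Sup K - Inf K) < \<delta>"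
    with sub show "(\<Sum>K\<in>\<D>. norm (f (Sup K) - f (Inf K))) < e"
      by (intro \<delta>[rule_format]) auto
  qed
qed

lemma absolutely_continuous_imp_continuous_on:
  assumes f: "absolutely_continuous_fun a b f"
  shows "continuous_on {a..b} f"
  unfolding continuous_on_iff
proof (intro ballI allI impI)
  fix x e :: real assume x: "x \<in> {a..b}" and "e > 0"
  obtain \<delta> where "\<delta> > 0" and \<delta>: "\<forall>\<D>. \<D> division_of \<Union>\<D> \<longrightarrow> \<Union>\<D> \<subseteq> {a..b} \<longrightarrow>
      (\<Sum>K\<in>\<D>. Sup K - Inf K) < \<delta> \<longrightarrow> (\<Sum>K\<in>\<D>. norm (f (Sup K) - f (Inf K))) < e"
    using absolutely_continuous_funD[OF f \<open>e > 0\<close>] by blast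
  have *: "norm (f t - f s) < e" if "s \<in> {a..b}" "t \<in> {a..b}" "s \<le> t" "t - s < \<delta>" for s t
    using \<delta>[rule_format, of "{{s..t}}"] that division_of_self[of s t] by auto
  have "dist (f y) (f x) < e" if "y \<in> {a..b}" "dist y x < \<delta>" for y
    using *[of x y] *[of y x] that x
    by (cases "x \<le> y") (auto simp: dist_norm norm_minus_commute)
  then show "\<exists>d>0. \<forall>x'\<in>{a..b}. dist x' x < d \<longrightarrow> dist (f x') (f x) < e"
    using \<open>\<delta> > 0\<close> by blast
qed

text \<open>
The fundamental theorem of calculus for the gauge integral, with an exceptional null set. Tags
outside the null set are handled by differentiability. Around tags in the null set the gauge is
chosen inside an open set of small measure, so that the intervals belonging to such tags have small
total length, and absolute continuity makes the increments of \<open>f\<close> over them small.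
\<close>

lemma has_integral_absolutely_continuous:
  fixes f :: "real \<Rightarrow> 'a::banach"
  assumes "a \<le> b" and ac: "absolutely_continuous_fun a b f"
    and deriv: "AE t in lebesgue_on {a..b}. (f has_vector_derivative f' t) (at t within {a..b})"
  shows "(f' has_integral (f b - f a)) {a..b}"
proof -
  obtain N where N: "negligible N"
    and vecd: "\<forall>t\<in>{a..b} - N. (f has_vector_derivative f' t) (at t within {a..b})"
    using deriv unfolding AE_lebesgue_on_interval_iff by blast
  define g where "g t = (if t \<in> N then 0 else f' t)" for t
  have "(g has_integral (f b - f a)) (cbox a b)"
    unfolding has_integral
  proof (intro allI impI)
    fix e :: real assume "e > 0"
    obtain \<delta> where "\<delta> > 0" and \<delta>: "\<forall>\<D>. \<D> division_of \<Union>\<D> \<longrightarrow> \<Union>\<D> \<subseteq> {a..b} \<longrightarrow>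
        (\<Sum>K\<in>\<D>. Sup K - Inf K) < \<delta> \<longrightarrow> (\<Sum>K\<in>\<D>. norm (f (Sup K) - f (Inf K))) < e / 2"
      using absolutely_continuous_funD[OF ac half_gt_zero[OF \<open>e > 0\<close>]] by blast
    define \<eta> where "\<eta> = e / (2 * (b - a + 1))"
    have "\<eta> > 0" and \<eta>: "\<eta> * (b - a) < e / 2"
      using \<open>e > 0\<close> \<open>a \<le> b\<close> by (auto simp: \<eta>_def field_simps)
    obtain G where "open G" "N \<subseteq> G" and G: "G - N \<in> lmeasurable" "emeasure lebesgue (G - N) < ennreal \<delta>"
      using sets_lebesgue_outer_open[OF _ \<open>\<delta> > 0\<close>, of N] N
      by (metis negligible_imp_sets)
    have Gm: "G \<in> lmeasurable" "measure lebesgue G < \<delta>"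
    proof -
      have eq: "G = (G - N) \<union> N" using \<open>N \<subseteq> G\<close> by blast
      show Gl: "G \<in> lmeasurable"
        by (subst eq) (intro fmeasurable.Un G negligible_imp_measurable N)
      have "measure lebesgue G = measure lebesgue (G - N)"
        using N Gl by (intro measure_Diff_null_set[symmetric]) (auto simp: negligible_iff_null_sets)
      also have "\<dots> < \<delta>"
        using G \<open>\<delta> > 0\<close> by (simp add: emeasure_eq_measure2 ennreal_less_iff)
      finally show "measure lebesgue G < \<delta>" .
    qed
    have "\<forall>x. \<exists>d>0. (x \<in> N \<longrightarrow> ball x d \<subseteq> G) \<and> (x \<in> {a..b} - N \<longrightarrow>
         (\<forall>y\<in>{a..b}. norm (y - x) < d \<longrightarrow> norm (f y - f x - (y - x) *\<^sub>R f' x) \<le> \<eta> * norm (y - x)))"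
      (is "\<forall>x. \<exists>d>0. ?P x d")
    proof
      fix x
      show "\<exists>d>0. ?P x d"
      proof (cases "x \<in> N")
        case True
        then show ?thesis
          using \<open>open G\<close> \<open>N \<subseteq> G\<close> by (meson DiffE open_contains_ball subsetD)
      next
        case False
        show ?thesis
        proof (cases "x \<in> {a..b}")
          case True
          then show ?thesis
            using False vecd[rule_format, of x] \<open>\<eta> > 0\<close>
            unfolding has_vector_derivative_def has_derivative_within_alt by blast
        qed (use False zero_less_one in blast)
      qed
    qed
    from choice[OF this] obtain d where "\<forall>x. d x > 0 \<and> ?P x (d x)" by blast
    then have dpos: "d x > 0" and d: "?P x (d x)" for x by simp_all
    show "\<exists>\<gamma>. gauge \<gamma> \<and> (\<forall>\<D>. \<D> tagged_division_of cbox a b \<and> \<gamma> fine \<D> \<longrightarrow>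
        norm ((\<Sum>(x, K)\<in>\<D>. measure lborel K *\<^sub>R g x) - (f b - f a)) < e)"
    proof (intro exI[of _ "\<lambda>x. ball x (d x)"] conjI allI impI; (elim conjE)?)
      show "gauge (\<lambda>x. ball x (d x))"
        using dpos gauge_ball_dependent by blast
      fix p assume ptag: "p tagged_division_of cbox a b" and fine: "(\<lambda>x. ball x (d x)) fine p"
      have fin: "finite p" using ptag by auto
      have ba: "b - a = (\<Sum>(x,K)\<in>p. Sup K - Inf K)" "f b - f a = (\<Sum>(x,K)\<in>p. f (Sup K) - f (Inf K))"
        using additive_tagged_division_1[OF \<open>a \<le> b\<close>, of p "\<lambda>x. x"]
          additive_tagged_division_1[OF \<open>a \<le> b\<close>, of p f] ptag by auto
      have piece: "\<exists>u v. K = {u..v} \<and> u \<le> x \<and> x \<le> v \<and> {u..v} \<subseteq> {a..b} \<and> {u..v} \<subseteq> ball x (d x)"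
        if "(x, K) \<in> p" for x K
      proof -
        have "x \<in> K" "K \<subseteq> {a..b}" "K \<subseteq> ball x (d x)"
          using ptag fine that by (auto simp: fine_def dest: tagged_division_ofD)
        moreover obtain u v where "K = cbox u v"
          using tagged_division_ofD(4)[OF ptag \<open>(x, K) \<in> p\<close>] by blast
        ultimately show ?thesis by auto
      qed
      let ?q = "{(x, K) \<in> p. x \<in> N}"
      \<comment> \<open>intervals with a regular tag: the two ends are compared with the tag\<close>
      have reg: "norm (measure lborel K *\<^sub>R g x - (f (Sup K) - f (Inf K))) \<le> \<eta> * (Sup K - Inf K)"
        if "(x, K) \<in> p - ?q" for x K
      proof -
        from that have xK: "(x, K) \<in> p" "x \<notin> N" by auto
        then obtain u v where K: "K = {u..v}" "u \<le> x" "x \<le> v" "{u..v} \<subseteq> {a..b}" "{u..v} \<subseteq> ball x (d x)"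
          using piece by blast
        then have "u \<in> {u..v}" "v \<in> {u..v}" "x \<in> {u..v}" by auto
        with K(4,5) have "u \<in> ball x (d x)" "v \<in> ball x (d x)"
          and uv: "u \<in> {a..b}" "v \<in> {a..b}" "x \<in> {a..b}" by blast+
        then have duv: "norm (u - x) < d x" "norm (v - x) < d x"
          by (simp_all add: dist_norm norm_minus_commute)
        have "measure lborel K *\<^sub>R g x - (f (Sup K) - f (Inf K))
            = (f u - f x - (u - x) *\<^sub>R f' x) - (f v - f x - (v - x) *\<^sub>R f' x)"
          using K xK by (simp add: g_def algebra_simps)
        also have "norm \<dots> \<le> norm (f u - f x - (u - x) *\<^sub>R f' x) + norm (f v - f x - (v - x) *\<^sub>R f' x)"
          by (rule norm_triangle_ineq4)
        also have "\<dots> \<le> \<eta> * norm (u - x) + \<eta> * norm (v - x)"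
          using d[of x] uv duv xK by (intro add_mono) auto
        also have "\<dots> = \<eta> * (Sup K - Inf K)"
          using K by (simp add: algebra_simps)
        finally show ?thesis .
      qed
      \<comment> \<open>intervals with a singular tag form a division inside \<open>G\<close>, to which absolute continuity applies\<close>
      have sing: "(\<Sum>(x,K)\<in>?q. norm (f (Sup K) - f (Inf K))) < e / 2"
      proof -
        have qtag: "?q tagged_partial_division_of cbox a b"
          using ptag unfolding tagged_division_of_def
          by (auto intro: tagged_partial_division_subset)
        \<comment> \<open>an interval carrying two tags is degenerate, hence contains only one point\<close>
        have inj: "inj_on snd ?q"
        proof (rule inj_onI)
          fix y z assume yz: "y \<in> ?q" "z \<in> ?q" "snd y = snd z"
          obtain x x' K where [simp]: "y = (x, K)" "z = (x', K)"
            using yz(3) by (metis prod.collapse)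
          have xK: "(x, K) \<in> p" "(x', K) \<in> p" using yz by auto
          obtain u v where K: "K = {u..v}" "u \<le> x" "x \<le> v" "u \<le> x'" "x' \<le> v"
            using piece[OF xK(1)] piece[OF xK(2)] by force
          show "y = z"
          proof (rule ccontr)
            assume "y \<noteq> z"
            then have "interior K \<inter> interior K = {}"
              using tagged_division_ofD(5)[OF ptag xK] by auto
            then have "u = v" using K by (simp add: interior_atLeastAtMost_real)
            then show False using K \<open>y \<noteq> z\<close> by auto
          qed
        qed
        let ?D = "snd ` ?q"
        have div: "?D division_of \<Union>?D"
          by (rule partial_division_of_tagged_division[OF qtag])
        have sub: "\<Union>?D \<subseteq> {a..b} \<inter> G"
        proof
          fix t assume "t \<in> \<Union>?D"
          then obtain x K where "(x, K) \<in> p" "x \<in> N" "t \<in> K" by auto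
          then show "t \<in> {a..b} \<inter> G"
            using piece[of x K] d[of x] by blast
        qed
        have "(\<Sum>K\<in>?D. Sup K - Inf K) = (\<Sum>K\<in>?D. measure lebesgue K)"
        proof (rule sum.cong)
          fix K assume "K \<in> ?D"
          then obtain x where "(x, K) \<in> p" by auto
          then show "Sup K - Inf K = measure lebesgue K" using piece[of x K] by auto
        qed auto
        also have "\<dots> = measure lebesgue (\<Union>?D)"
          by (rule content_division[OF div])
        also have "\<dots> \<le> measure lebesgue G"
          using sub by (intro measure_mono_fmeasurable Gm lmeasurable_division[THEN fmeasurableD, OF div]) auto
        finally have "(\<Sum>K\<in>?D. Sup K - Inf K) < \<delta>" using Gm by simp
        then have "(\<Sum>K\<in>?D. norm (f (Sup K) - f (Inf K))) < e / 2"
          using sub by (intro \<delta>[rule_format] div) auto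
        then show ?thesis
          by (subst (asm) sum.reindex[OF inj]) (simp add: case_prod_unfold)
      qed
      have "norm ((\<Sum>(x, K)\<in>p. measure lborel K *\<^sub>R g x) - (f b - f a))
          = norm (\<Sum>(x,K)\<in>p. measure lborel K *\<^sub>R g x - (f (Sup K) - f (Inf K)))"
        unfolding ba by (simp add: case_prod_unfold sum_subtractf)
      also have "\<dots> \<le> (\<Sum>(x,K)\<in>p. norm (measure lborel K *\<^sub>R g x - (f (Sup K) - f (Inf K))))"
        by (intro sum_norm_le) auto
      also have "\<dots> = (\<Sum>(x,K)\<in>p - ?q. norm (measure lborel K *\<^sub>R g x - (f (Sup K) - f (Inf K))))
          + (\<Sum>(x,K)\<in>?q. norm (measure lborel K *\<^sub>R g x - (f (Sup K) - f (Inf K))))"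
        by (intro sum.subset_diff fin) auto
      also have "(\<Sum>(x,K)\<in>?q. norm (measure lborel K *\<^sub>R g x - (f (Sup K) - f (Inf K))))
          = (\<Sum>(x,K)\<in>?q. norm (f (Sup K) - f (Inf K)))"
        by (intro sum.cong) (auto simp: g_def norm_minus_commute)
      also have "(\<Sum>(x,K)\<in>p - ?q. norm (measure lborel K *\<^sub>R g x - (f (Sup K) - f (Inf K))))
          \<le> (\<Sum>(x,K)\<in>p - ?q. \<eta> * (Sup K - Inf K))"
        using reg by (intro sum_mono) auto
      also have "\<dots> \<le> (\<Sum>(x,K)\<in>p. \<eta> * (Sup K - Inf K))"
      proof (intro sum_mono2 fin)
        fix y assume "y \<in> p - (p - ?q)"
        then obtain x K where "y = (x, K)" "(x, K) \<in> p" by auto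
        then show "0 \<le> (case y of (x, K) \<Rightarrow> \<eta> * (Sup K - Inf K))"
          using piece[of x K] \<open>\<eta> > 0\<close> by auto
      qed auto
      also have "\<dots> = \<eta> * (b - a)"
        unfolding ba by (simp add: case_prod_unfold sum_distrib_left)
      finally show "norm ((\<Sum>(x, K)\<in>p. measure lborel K *\<^sub>R g x) - (f b - f a)) < e"
        using sing \<eta> by linarith
    qed
  qed
  then have "(g has_integral (f b - f a)) {a..b}" by simp
  then show ?thesis
    by (rule has_integral_spike[OF N, rotated]) (auto simp: g_def)
qed

lemma has_integral_absolutely_continuous_subinterval:
  fixes f :: "real \<Rightarrow> 'a::banach"
  assumes ac: "absolutely_continuous_fun a b f"
    and deriv: "AE t in lebesgue_on {a..b}. (f has_vector_derivative f' t) (at t within {a..b})"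
    and st: "a \<le> s" "s \<le> t" "t \<le> b"
  shows "(f' has_integral (f t - f s)) {s..t}"
proof (rule has_integral_absolutely_continuous[OF \<open>s \<le> t\<close>])
  have sub: "{s..t} \<subseteq> {a..b}" using st by auto
  show "absolutely_continuous_fun s t f"
    by (rule absolutely_continuous_subinterval[OF ac sub])
  from deriv obtain N where "negligible N"
    and N: "\<forall>r\<in>{a..b} - N. (f has_vector_derivative f' r) (at r within {a..b})"
    unfolding AE_lebesgue_on_interval_iff by blast
  then show "AE r in lebesgue_on {s..t}. (f has_vector_derivative f' r) (at r within {s..t})"
    unfolding AE_lebesgue_on_interval_iff using sub
    by (intro exI[of _ N] conjI ballI has_vector_derivative_within_subset[OF _ sub]) auto
qed

lemma lipschitz_if_has_integral_bounded:
  fixes f :: "real \<Rightarrow> 'a::real_normed_vector"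
  assumes int: "\<And>s t. a \<le> s \<Longrightarrow> s \<le> t \<Longrightarrow> t \<le> b \<Longrightarrow> (f' has_integral (f t - f s)) {s..t}"
    and bound: "\<And>t. t \<in> {a..b} \<Longrightarrow> norm (f' t) \<le> C" and "C \<ge> 0"
  shows "C-lipschitz_on {a..b} f"
proof (rule lipschitz_on_leI)
  fix s t assume st: "s \<in> {a..b}" "t \<in> {a..b}" "s \<le> t"
  have "norm (f t - f s) \<le> C * measure lborel (cbox s t)"
    using int[of s t] st by (intro has_integral_bound[of C f'] bound \<open>C \<ge> 0\<close>) auto
  then show "dist (f s) (f t) \<le> C * dist s t"
    using st by (simp add: dist_norm norm_minus_commute)
qed fact

lemma lipschitz_on_inner:
  fixes f g :: "real \<Rightarrow> 'a::euclidean_space"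
  assumes f: "C-lipschitz_on {a..b} f" and g: "D-lipschitz_on {a..b} g"
  obtains L where "L-lipschitz_on {a..b} (\<lambda>t. f t \<bullet> g t)"
proof -
  have "bounded (f ` {a..b})" "bounded (g ` {a..b})"
    using f g by (auto intro!: compact_imp_bounded compact_continuous_image lipschitz_on_continuous_on)
  then obtain F G where F: "F > 0" "\<forall>t\<in>{a..b}. norm (f t) \<le> F" and G: "G > 0" "\<forall>t\<in>{a..b}. norm (g t) \<le> G"
    unfolding bounded_pos by auto
  have CD: "C \<ge> 0" "D \<ge> 0" using f g lipschitz_on_nonneg by auto
  have "(F * D + C * G)-lipschitz_on {a..b} (\<lambda>t. f t \<bullet> g t)"
  proof (rule lipschitz_onI)
    fix s t assume st: "s \<in> {a..b}" "t \<in> {a..b}"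
    have "f s \<bullet> g s - f t \<bullet> g t = f s \<bullet> (g s - g t) + (f s - f t) \<bullet> g t"
      by (simp add: algebra_simps)
    also have "\<bar>\<dots>\<bar> \<le> norm (f s) * norm (g s - g t) + norm (f s - f t) * norm (g t)"
      by (intro order_trans[OF abs_triangle_ineq] add_mono Cauchy_Schwarz_ineq2)
    also have "\<dots> \<le> F * (D * norm (s - t)) + C * norm (s - t) * G"
      using F G CD st
      by (intro add_mono mult_mono lipschitz_on_normD[OF f] lipschitz_on_normD[OF g]) auto
    finally show "dist (f s \<bullet> g s) (f t \<bullet> g t) \<le> (F * D + C * G) * dist s t"
      by (simp add: dist_norm algebra_simps)
  qed (use CD F G in auto)
  then show thesis by (rule that)
qed


text \<open>
A substitute for Lebesgue's differentiation theorem. By Henstock's lemma, \<open>\<Sum> \<bar>\<bar>K\<bar> g x - \<integral>\<^sub>K g\<bar>\<close> is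
small over fine tagged divisions. Where \<open>g x < 0\<close>, the lower bound on \<open>\<integral>\<^sub>K g\<close> makes this
difference at least \<open>\<bar>K\<bar> \<bar>g x\<bar>\<close> up to a quadratic term, which is negligible for short \<open>K\<close>. Hence
all Riemann sums of the negative part of \<open>g\<close> over fine divisions are small, and its integral is zero.
\<close>

lemma AE_nonneg_if_integral_ge_quadratic:
  fixes g :: "real \<Rightarrow> real"
  assumes int: "g integrable_on {a..b}" and "h > 0"
    and ge: "\<And>s t. a \<le> s \<Longrightarrow> s \<le> t \<Longrightarrow> t \<le> b \<Longrightarrow> t - s \<le> h \<Longrightarrow> integral {s..t} g \<ge> - C * (t - s)\<^sup>2"
  shows "AE t in lebesgue_on {a..b}. g t \<ge> 0"
proof -
  let ?n = "\<lambda>x. max 0 (- g x)"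
  have "(?n has_integral 0) (cbox a b)"
    unfolding has_integral
  proof (intro allI impI)
    fix e :: real assume "e > 0"
    define D where "D = 2 * \<bar>C\<bar> * (\<bar>b - a\<bar> + 1) + 1"
    have "D > 0" unfolding D_def by (intro add_nonneg_pos) auto
    define r where "r = min (h / 2) (e / (2 * D))"
    have "r > 0" using \<open>e > 0\<close> \<open>h > 0\<close> \<open>D > 0\<close> by (simp add: r_def)
    obtain \<gamma> where "gauge \<gamma>" and \<gamma>: "\<And>p. p tagged_partial_division_of (cbox a b) \<Longrightarrow> \<gamma> fine p \<Longrightarrow>
             (\<Sum>(x,K)\<in>p. norm (measure lborel K *\<^sub>R g x - integral K g)) < e / 2"
      using Henstock_lemma[of g a b "e / 2"] int \<open>e > 0\<close> by (auto simp: case_prod_unfold)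
    show "\<exists>\<gamma>. gauge \<gamma> \<and> (\<forall>\<D>. \<D> tagged_division_of cbox a b \<and> \<gamma> fine \<D> \<longrightarrow>
        norm ((\<Sum>(x, K)\<in>\<D>. measure lborel K *\<^sub>R ?n x) - 0) < e)"
    proof (intro exI[of _ "\<lambda>x. \<gamma> x \<inter> ball x r"] conjI allI impI; (elim conjE)?)
      show "gauge (\<lambda>x. \<gamma> x \<inter> ball x r)"
        using \<open>gauge \<gamma>\<close> \<open>r > 0\<close> by (intro gauge_Int gauge_ball)
      fix p assume ptag: "p tagged_division_of cbox a b" and "(\<lambda>x. \<gamma> x \<inter> ball x r) fine p"
      then have fine: "\<gamma> fine p" "(\<lambda>x. ball x r) fine p" by (auto simp: fine_Int)
      have ptag': "p tagged_partial_division_of cbox a b"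
        using ptag by (simp add: tagged_division_of_def)
      have le: "measure lborel K *\<^sub>R ?n x \<le> norm (measure lborel K *\<^sub>R g x - integral K g) + \<bar>C\<bar> * (2 * r) * measure lborel K"
        if xK: "(x, K) \<in> p" for x K
      proof -
        have "x \<in> K" "K \<subseteq> {a..b}" "K \<subseteq> ball x r"
          using ptag fine(2) that by (auto simp: fine_def dest: tagged_division_ofD)
        moreover obtain u v where "K = cbox u v"
          using tagged_division_ofD(4)[OF ptag \<open>(x, K) \<in> p\<close>] by blast
        ultimately have K: "K = {u..v}" "u \<le> v" "a \<le> u" "v \<le> b" "{u..v} \<subseteq> ball x r"
          by auto
        then have "u \<in> ball x r" "v \<in> ball x r" by (simp_all add: subset_iff)
        then have "v - u \<le> 2 * r" by (simp add: dist_real_def)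
        moreover have "2 * r \<le> h" by (simp add: r_def)
        ultimately have "integral K g \<ge> - C * (v - u)\<^sup>2"
          using ge[of u v] K by simp
        moreover have "C * (v - u)\<^sup>2 \<le> \<bar>C\<bar> * (2 * r) * (v - u)"
        proof -
          have "C * (v - u)\<^sup>2 \<le> \<bar>C\<bar> * ((v - u) * (v - u))"
            by (simp add: power2_eq_square mult_right_mono)
          also have "\<dots> \<le> \<bar>C\<bar> * (2 * r * (v - u))"
            using \<open>v - u \<le> 2 * r\<close> K by (intro mult_left_mono mult_right_mono) auto
          finally show ?thesis by (simp add: mult.assoc)
        qed
        moreover have "measure lborel K = v - u" using K by simp
        moreover have "0 \<le> \<bar>C\<bar> * (2 * r) * (v - u)" using K \<open>r > 0\<close> by simp
        ultimately show ?thesis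
          by (cases "g x \<ge> 0") auto
      qed
      have "(\<Sum>(x, K)\<in>p. measure lborel K *\<^sub>R ?n x)
          \<le> (\<Sum>(x, K)\<in>p. norm (measure lborel K *\<^sub>R g x - integral K g) + \<bar>C\<bar> * (2 * r) * measure lborel K)"
        using le by (intro sum_mono) auto
      also have "\<dots> = (\<Sum>(x, K)\<in>p. norm (measure lborel K *\<^sub>R g x - integral K g))
          + \<bar>C\<bar> * (2 * r) * (\<Sum>(x, K)\<in>p. measure lborel K)"
        by (simp add: case_prod_unfold sum.distrib sum_distrib_left)
      also have "(\<Sum>(x, K)\<in>p. measure lborel K) = measure lborel (cbox a b)"
        by (rule additive_content_tagged_division[OF ptag])
      also have "\<bar>C\<bar> * (2 * r) * measure lborel (cbox a b) \<le> D * r"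
      proof -
        have "measure lborel (cbox a b) \<le> \<bar>b - a\<bar> + 1" by (auto simp: content_real_if)
        then have "\<bar>C\<bar> * (2 * r) * measure lborel (cbox a b) \<le> \<bar>C\<bar> * (2 * r) * (\<bar>b - a\<bar> + 1)"
          using \<open>r > 0\<close> by (intro mult_left_mono) auto
        then show ?thesis using \<open>r > 0\<close> by (simp add: D_def algebra_simps)
      qed
      also have "\<dots> \<le> e / 2"
      proof -
        have "D * r \<le> D * (e / (2 * D))" using \<open>D > 0\<close> by (intro mult_left_mono) (auto simp: r_def)
        then show ?thesis using \<open>D > 0\<close> by simp
      qed
      finally have "(\<Sum>(x, K)\<in>p. measure lborel K *\<^sub>R ?n x) < e"
        using \<gamma>[OF ptag' fine(1)] by linarith
      moreover have "0 \<le> (\<Sum>(x, K)\<in>p. measure lborel K *\<^sub>R ?n x)"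
        by (intro sum_nonneg) auto
      ultimately show "norm ((\<Sum>(x, K)\<in>p. measure lborel K *\<^sub>R ?n x) - 0) < e" by simp
    qed
  qed
  then have "(?n has_integral 0) {a..b}" by simp
  then have i0: "?n integrable_on {a..b}" "integral {a..b} ?n = 0"
    by (auto intro: integral_unique)
  have "?n absolutely_integrable_on {a..b}"
    by (rule nonnegative_absolutely_integrable_1[OF i0(1)]) auto
  then have L: "integrable (lebesgue_on {a..b}) ?n"
    by (simp add: absolutely_integrable_imp_integrable)
  have "integral\<^sup>L (lebesgue_on {a..b}) ?n = 0"
    using lebesgue_integral_eq_integral[OF L] i0 by simp
  then have "AE t in lebesgue_on {a..b}. ?n t = 0"
    by (subst (asm) integral_nonneg_eq_0_iff_AE[OF L]) auto
  then show ?thesis by eventually_elim auto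
qed

section \<open>Linear differential equations with constant coefficients\<close>

text \<open>
The exponential series of \<open>F\<close> applied to the initial value; term-by-term differentiation is
reduced to scalar power series by pairing with a basis vector.
\<close>

lemma linear_ode_solution:
  fixes F :: "'a::euclidean_space \<Rightarrow> 'a"
  assumes "linear F"
  obtains x where "x 0 = x0"
    "\<And>t. (x has_vector_derivative F (x t)) (at t)"
    "\<And>t. norm (x t) \<le> exp (onorm F * \<bar>t\<bar>) * norm x0"
proof -
  have bl: "bounded_linear F"
    using assms by (simp add: linear_conv_bounded_linear)
  define K where "K = onorm F"
  have K0: "K \<ge> 0"
    unfolding K_def by (rule onorm_pos_le[OF bl])
  have iter: "norm ((F ^^ n) x0) \<le> K ^ n * norm x0" for n
  proof (induction n)
    case (Suc n)
    have "norm (F ((F ^^ n) x0)) \<le> K * norm ((F ^^ n) x0)"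
      unfolding K_def by (rule onorm[OF bl])
    also have "\<dots> \<le> K * (K ^ n * norm x0)"
      by (intro mult_left_mono Suc K0)
    finally show ?case by (simp add: mult_ac)
  qed simp
  define X where "X t n = (t ^ n / fact n) *\<^sub>R (F ^^ n) x0" for t n
  have bound: "norm (X t n) \<le> (K * \<bar>t\<bar>) ^ n /\<^sub>R fact n * norm x0" for t n
  proof -
    have "norm (X t n) = \<bar>t\<bar> ^ n / fact n * norm ((F ^^ n) x0)"
      by (simp add: X_def power_abs)
    also have "\<dots> \<le> \<bar>t\<bar> ^ n / fact n * (K ^ n * norm x0)"
      by (intro mult_left_mono iter) auto
    finally show ?thesis
      by (simp add: power_mult_distrib field_simps)
  qed
  have exp_sums: "(\<lambda>n. (K * \<bar>t\<bar>) ^ n /\<^sub>R fact n * norm x0) sums (exp (K * \<bar>t\<bar>) * norm x0)" for t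
    by (intro sums_mult2 exp_converges)
  have summ_norm: "summable (\<lambda>n. norm (X t n))" for t
    by (rule summable_comparison_test'[OF sums_summable[OF exp_sums[of t]], of 0])
      (use bound in auto)
  have summ: "summable (X t)" for t
    by (rule summable_norm_cancel[OF summ_norm])
  define x where "x t = suminf (X t)" for t
  have x_inner: "x t \<bullet> i = (\<Sum>n. ((F ^^ n) x0 \<bullet> i / fact n) * t ^ n)" for t i
  proof -
    have "x t \<bullet> i = (\<Sum>n. X t n \<bullet> i)"
      unfolding x_def by (rule bounded_linear.suminf[OF bounded_linear_inner_left summ])
    then show ?thesis by (simp add: X_def mult_ac)
  qed
  have summ_inner: "summable (\<lambda>n. ((F ^^ n) x0 \<bullet> i / fact n) * t ^ n)" for t i
  proof -
    have "summable (\<lambda>n. X t n \<bullet> i)"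
      by (rule bounded_linear.summable[OF bounded_linear_inner_left summ])
    then show ?thesis by (simp add: X_def mult_ac)
  qed
  have Fx_inner: "F (x t) \<bullet> i = (\<Sum>n. diffs (\<lambda>n. (F ^^ n) x0 \<bullet> i / fact n) n * t ^ n)" for t i
  proof -
    have "F (x t) \<bullet> i = (\<Sum>n. F (X t n) \<bullet> i)"
      unfolding x_def
      by (rule bounded_linear.suminf[OF bounded_linear_compose[OF bounded_linear_inner_left bl] summ])
    also have "(\<lambda>n. F (X t n) \<bullet> i) = (\<lambda>n. diffs (\<lambda>n. (F ^^ n) x0 \<bullet> i / fact n) n * t ^ n)"
      by (auto simp: X_def diffs_def linear_cmul[OF assms] field_simps simp del: of_nat_Suc)
    finally show ?thesis .
  qed
  have deriv: "(x has_vector_derivative F (x t)) (at t)" for t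
    unfolding has_vector_derivative_def
  proof (subst has_derivative_componentwise_within, intro ballI)
    fix i :: 'a assume "i \<in> Basis"
    have "((\<lambda>t. x t \<bullet> i) has_field_derivative (F (x t) \<bullet> i)) (at t)"
      unfolding x_inner Fx_inner
      by (rule termdiffs_strong_converges_everywhere[OF summ_inner])
    then show "((\<lambda>t. x t \<bullet> i) has_derivative (\<lambda>h. (h *\<^sub>R F (x t)) \<bullet> i)) (at t)"
      unfolding has_field_derivative_def
      by (rule has_derivative_eq_rhs) (auto simp: mult.commute)
  qed
  have "x 0 = x0"
    by (rule euclidean_eqI) (simp add: x_inner del: times_divide_eq_left)
  moreover have "norm (x t) \<le> exp (K * \<bar>t\<bar>) * norm x0" for t
  proof -
    have "norm (x t) \<le> (\<Sum>n. norm (X t n))"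
      unfolding x_def by (rule summable_norm[OF summ_norm])
    also have "\<dots> \<le> exp (K * \<bar>t\<bar>) * norm x0"
      unfolding sums_unique[OF exp_sums]
      by (rule suminf_le[OF bound summ_norm sums_summable[OF exp_sums]])
    finally show ?thesis .
  qed
  ultimately show thesis
    using that deriv unfolding K_def by blast
qed


lemma linear_flow_lipschitz:
  fixes x :: "real \<Rightarrow> 'a::euclidean_space"
  assumes "linear F" and x: "\<And>t. (x has_vector_derivative F (x t)) (at t)"
    and bound: "\<And>t. t \<in> {a..b} \<Longrightarrow> norm (x t) \<le> M" and "M \<ge> 0"
  shows "(onorm F * M)-lipschitz_on {a..b} x"
proof (rule lipschitz_if_has_integral_bounded)
  have bl: "bounded_linear F" using assms(1) by (simp add: linear_conv_bounded_linear)
  show "((\<lambda>t. F (x t)) has_integral x t - x s) {s..t}" if "s \<le> t" for s t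
    using that by (intro fundamental_theorem_of_calculus) (auto intro: has_vector_derivative_at_within x)
  show "norm (F (x t)) \<le> onorm F * M" if "t \<in> {a..b}" for t
    using onorm[OF bl, of "x t"] mult_left_mono[OF bound[OF that] onorm_pos_le[OF bl]] by linarith
  show "0 \<le> onorm F * M" using onorm_pos_le[OF bl] \<open>M \<ge> 0\<close> by simp
qed


lemma has_vector_derivative_shift:
  assumes "(f has_vector_derivative f') (at (r - s))"
  shows "((\<lambda>r. f (r - s)) has_vector_derivative f') (at r)"
proof -
  have "((\<lambda>r. r - s) has_vector_derivative 1) (at r)"
    by (auto intro!: derivative_eq_intros)
  from vector_diff_chain_at[OF this assms] show ?thesis by (simp add: o_def)
qed


section \<open>Needle variations of a trajectory\<close>

lemma admissible_has_integral:
  assumes "admissible A B V T xbar x u" and "0 \<le> s" "s \<le> t" "t \<le> T"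
  shows "((\<lambda>t. A *v x t + B *v u t) has_integral (x t - x s)) {s..t}"
  using assms unfolding admissible_def
  by (intro has_integral_absolutely_continuous_subinterval[of 0 T x]) blast+

lemma admissible_lipschitz:
  assumes adm: "admissible A B V T xbar x u" and "bounded V"
  obtains C where "C-lipschitz_on {0..T} x"
proof -
  have "continuous_on {0..T} x"
    using adm by (simp add: admissible_def absolutely_continuous_imp_continuous_on)
  then have "bounded (x ` {0..T})"
    by (intro compact_imp_bounded compact_continuous_image) auto
  then obtain M where M: "M > 0" "\<forall>t\<in>{0..T}. norm (x t) \<le> M"
    unfolding bounded_pos by auto
  obtain R where R: "R > 0" "\<forall>v\<in>V. norm v \<le> R"
    using \<open>bounded V\<close> unfolding bounded_pos by auto
  note [simp] = onorm_pos_le[OF matrix_vector_mul_bounded_linear]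
  have "(onorm ((*v) A) * M + onorm ((*v) B) * R)-lipschitz_on {0..T} x"
  proof (rule lipschitz_if_has_integral_bounded)
    fix s t assume "0 \<le> s" "s \<le> t" "t \<le> T"
    then show "((\<lambda>t. A *v x t + B *v u t) has_integral (x t - x s)) {s..t}"
      by (rule admissible_has_integral[OF adm])
  next
    fix t assume t: "t \<in> {0..T}"
    then have "u t \<in> V" using adm by (simp add: admissible_def)
    have "norm (A *v x t + B *v u t) \<le> onorm ((*v) A) * norm (x t) + onorm ((*v) B) * norm (u t)"
      by (intro order_trans[OF norm_triangle_ineq] add_mono onorm matrix_vector_mul_bounded_linear)
    also have "\<dots> \<le> onorm ((*v) A) * M + onorm ((*v) B) * R"
      using M R t \<open>u t \<in> V\<close> by (intro add_mono mult_left_mono) auto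
    finally show "norm (A *v x t + B *v u t) \<le> onorm ((*v) A) * M + onorm ((*v) B) * R" .
  qed (use M R in auto)
  then show thesis by (rule that)
qed

lemma inner_adjoint_cancel:
  fixes A :: "real ^ 'd ^ 'd"
  shows "(- (transpose A *v p)) \<bullet> y + p \<bullet> (A *v y + w) = p \<bullet> w"
  by (simp add: inner_add_right dot_lmul_matrix)

text \<open>
Along the adjoint equation the drift terms of \<open>(p \<bullet> x)'\<close> cancel, so that only the control
contribution \<open>p \<bullet> B u\<close> remains. This is what turns the effect of a control variation on the end
point \<open>x T\<close> into an integral over time.
\<close>

lemma adjoint_pairing_has_integral:
  assumes adm: "admissible A B V T xbar x u" and "bounded V"
    and p: "\<And>t. (p has_vector_derivative - (transpose A *v p t)) (at t)"
    and st: "0 \<le> s" "s \<le> t" "t \<le> T"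
  shows "((\<lambda>t. p t \<bullet> (B *v u t)) has_integral (p t \<bullet> x t - p s \<bullet> x s)) {s..t}"
proof -
  obtain C where C: "C-lipschitz_on {0..T} x"
    using admissible_lipschitz[OF adm \<open>bounded V\<close>] .
  have "continuous_on {0..T} p"
    by (intro continuous_at_imp_continuous_on ballI has_vector_derivative_continuous[OF p])
  then have "bounded (p ` {0..T})"
    by (intro compact_imp_bounded compact_continuous_image) auto
  then obtain M where M: "M > 0" "\<forall>t\<in>{0..T}. norm (p t) \<le> M"
    unfolding bounded_pos by auto
  obtain L where L: "L-lipschitz_on {0..T} (\<lambda>t. p t \<bullet> x t)"
  proof (rule lipschitz_on_inner[OF linear_flow_lipschitz[of "\<lambda>y. - (transpose A *v y)" p] C])
    show "linear (\<lambda>y. - (transpose A *v y))"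
      by (intro linear_compose_neg matrix_vector_mul_linear)
  qed (use p M in auto)
  from adm obtain N where "negligible N"
    and N: "\<forall>t\<in>{0..T} - N. (x has_vector_derivative (A *v x t + B *v u t)) (at t within {0..T})"
    unfolding admissible_def AE_lebesgue_on_interval_iff by blast
  have "((\<lambda>t. p t \<bullet> x t) has_vector_derivative p t \<bullet> (B *v u t)) (at t within {0..T})"
    if "t \<in> {0..T} - N" for t
  proof -
    have "((\<lambda>t. p t \<bullet> x t) has_vector_derivative
        (p t \<bullet> (A *v x t + B *v u t) + (- (transpose A *v p t)) \<bullet> x t)) (at t within {0..T})"
      by (rule bounded_bilinear.has_vector_derivative[OF bounded_bilinear_inner
            has_vector_derivative_at_within[OF p] N[rule_format, OF that]])
    moreover have "p t \<bullet> (A *v x t + B *v u t) + (- (transpose A *v p t)) \<bullet> x t = p t \<bullet> (B *v u t)"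
      by (subst add.commute) (rule inner_adjoint_cancel)
    ultimately show ?thesis by simp
  qed
  then have "AE t in lebesgue_on {0..T}.
      ((\<lambda>t. p t \<bullet> x t) has_vector_derivative p t \<bullet> (B *v u t)) (at t within {0..T})"
    unfolding AE_lebesgue_on_interval_iff using \<open>negligible N\<close> by (intro exI[of _ N] conjI ballI)
  from has_integral_absolutely_continuous_subinterval
    [OF lipschitz_imp_absolutely_continuous[OF L] this st]
  show ?thesis .
qed

text \<open>
The trajectory of a needle variation is glued from three pieces: the reference trajectory, the
solution \<open>z\<close> for the constant control \<open>v\<close>, and the reference trajectory plus a solution of the
homogeneous equation. Hence the derivative at almost every time comes from that of \<open>xs\<close>, and no
variation-of-constants integral of the measurable control has to be differentiated. The constant \<open>C\<close>
does not depend on the position of the needle.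
\<close>

lemma needle_trajectory:
  fixes A :: "real ^ 'd ^ 'd" and B :: "real ^ 'm ^ 'd"
  assumes adm: "admissible A B V T xbar xs us" and "bounded V" and "v \<in> V"
  shows "\<exists>C\<ge>0. \<forall>s t. 0 \<le> s \<longrightarrow> s \<le> t \<longrightarrow> t \<le> T \<longrightarrow>
    (\<exists>x. admissible A B V T xbar x (\<lambda>r. if r \<in> {s..t} then v else us r) \<and>
      (\<forall>r\<in>{0..T}. norm (x r - xs r) \<le> C * (t - s)))"
proof -
  obtain L where L: "L-lipschitz_on {0..T} xs"
    using admissible_lipschitz[OF adm \<open>bounded V\<close>] .
  have "L \<ge> 0" using L lipschitz_on_nonneg by blast
  have "bounded (xs ` {0..T})"
    using L by (intro compact_imp_bounded compact_continuous_image lipschitz_on_continuous_on) auto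
  then obtain M where M: "M > 0" "\<forall>t\<in>{0..T}. norm (xs t) \<le> M"
    unfolding bounded_pos by auto
  from adm obtain N where "negligible N"
    and N: "\<forall>r\<in>{0..T} - N. (xs has_vector_derivative (A *v xs r + B *v us r)) (at r within {0..T})"
    unfolding admissible_def AE_lebesgue_on_interval_iff by blast
  \<comment> \<open>the inhomogeneous equation \<open>y' = A y + w\<close> with constant \<open>w\<close>, as a homogeneous one for the pair\<close>
  define F where "F = (\<lambda>(y, w). (A *v y + w, 0 :: real ^ 'd))"
  have linF: "linear F"
    by (rule linearI) (auto simp: F_def matrix_vector_right_distrib scaleR_matrix_vector_assoc
        vector_scaleR_matrix_ac algebra_simps)
  have linA: "linear ((*v) A)" by simp
  have pos: "onorm F \<ge> 0" "onorm ((*v) A) \<ge> 0"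
    using linF linA by (simp_all add: linear_conv_bounded_linear onorm_pos_le)
  define E where "E = exp (onorm F * T) * (M + norm (B *v v))"
  define D where "D = onorm F * E + L"
  define G where "G = exp (onorm ((*v) A) * T)"
  have "E \<ge> 0" using M by (simp add: E_def)
  then have "D \<ge> 0" using pos \<open>L \<ge> 0\<close> by (simp add: D_def)
  show ?thesis
  proof (intro exI[of _ "G * D"] conjI allI impI)
    show "G * D \<ge> 0" using \<open>D \<ge> 0\<close> by (simp add: G_def)
    fix s t assume st: "0 \<le> s" "s \<le> t" "t \<le> T"
    have "G \<ge> 1" using pos st by (simp add: G_def)
    obtain Z where Z0: "Z 0 = (xs s, B *v v)" and Z: "\<And>r. (Z has_vector_derivative F (Z r)) (at r)"
      and Zbound: "\<And>r. norm (Z r) \<le> exp (onorm F * \<bar>r\<bar>) * norm (xs s, B *v v)"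
      using linear_ode_solution[OF linF] by metis
    define z where "z r = fst (Z (r - s))" for r
    have "((\<lambda>r. snd (Z r)) has_vector_derivative 0) (at r)" for r
      using bounded_linear.has_vector_derivative[OF bounded_linear_snd Z[of r]]
      by (simp add: F_def case_prod_unfold)
    then obtain c where "\<And>r. snd (Z r) = c"
      using has_vector_derivative_zero_constant[of UNIV "\<lambda>r. snd (Z r)"] by auto
    then have sndZ: "snd (Z r) = B *v v" for r using Z0 by (metis snd_conv)
    have z: "(z has_vector_derivative (A *v z r + B *v v)) (at r)" for r
    proof -
      have "((\<lambda>r. Z (r - s)) has_vector_derivative F (Z (r - s))) (at r)"
        by (rule has_vector_derivative_shift[OF Z])
      from bounded_linear.has_vector_derivative[OF bounded_linear_fst this]
      show ?thesis by (simp add: z_def[abs_def] F_def case_prod_unfold sndZ)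
    qed
    have zs: "z s = xs s" by (simp add: z_def Z0)
    have "norm (Z r) \<le> E" if "r \<in> {0..T}" for r
    proof -
      have "norm (xs s, B *v v) \<le> M + norm (B *v v)"
        using M(2) st by (intro order_trans[OF norm_Pair_le] add_mono) auto
      moreover have "onorm F * \<bar>r\<bar> \<le> onorm F * T"
        using that pos by (intro mult_left_mono) auto
      ultimately have "exp (onorm F * \<bar>r\<bar>) * norm (xs s, B *v v) \<le> E"
        unfolding E_def by (intro mult_mono) auto
      with Zbound[of r] show ?thesis by linarith
    qed
    then have LZ: "(onorm F * E)-lipschitz_on {0..T} Z"
      using \<open>E \<ge> 0\<close> by (intro linear_flow_lipschitz linF Z) auto
    have Lz: "(onorm F * E)-lipschitz_on {s..T} z"
    proof (rule lipschitz_onI)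
      fix a b assume "a \<in> {s..T}" "b \<in> {s..T}"
      then have "dist (Z (a - s)) (Z (b - s)) \<le> onorm F * E * dist (a - s) (b - s)"
        using st by (intro lipschitz_onD[OF LZ]) auto
      then show "dist (z a) (z b) \<le> onorm F * E * dist a b"
        using dist_fst_le[of "Z (a - s)" "Z (b - s)"] by (simp add: z_def dist_norm)
    qed (use pos \<open>E \<ge> 0\<close> in simp)
    obtain y where y0: "y 0 = z t - xs t" and y: "\<And>r. (y has_vector_derivative A *v y r) (at r)"
      and ybound: "\<And>r. norm (y r) \<le> exp (onorm ((*v) A) * \<bar>r\<bar>) * norm (z t - xs t)"
      using linear_ode_solution[OF linA] by metis
    have ybound': "norm (y r) \<le> G * norm (z t - xs t)" if "r \<in> {0..T}" for r
    proof -
      have "onorm ((*v) A) * \<bar>r\<bar> \<le> onorm ((*v) A) * T"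
        using that pos by (intro mult_left_mono) auto
      then have "exp (onorm ((*v) A) * \<bar>r\<bar>) * norm (z t - xs t) \<le> G * norm (z t - xs t)"
        unfolding G_def by (intro mult_right_mono) auto
      with ybound[of r] show ?thesis by linarith
    qed
    have Ly: "(onorm ((*v) A) * (G * norm (z t - xs t)))-lipschitz_on {0..T} y"
      using ybound' \<open>G \<ge> 1\<close> by (intro linear_flow_lipschitz linA y) auto
    define w where "w r = xs r + y (r - t)" for r
    have w: "(w has_vector_derivative (A *v w r + B *v us r)) (at r within {0..T})"
      if "r \<in> {0..T} - N" for r
    proof -
      have "((\<lambda>r. y (r - t)) has_vector_derivative A *v y (r - t)) (at r)"
        by (rule has_vector_derivative_shift[OF y])
      from has_vector_derivative_add[OF N[rule_format, OF that] has_vector_derivative_at_within[OF this]]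
      show ?thesis by (simp add: w_def[abs_def] matrix_vector_right_distrib algebra_simps)
    qed
    have Lw: "(L + onorm ((*v) A) * (G * norm (z t - xs t)))-lipschitz_on {t..T} w"
    proof (rule lipschitz_onI)
      fix a b assume ab: "a \<in> {t..T}" "b \<in> {t..T}"
      have "dist (w a) (w b) \<le> dist (xs a) (xs b) + dist (y (a - t)) (y (b - t))"
        unfolding w_def by (rule dist_triangle_add)
      also have "\<dots> \<le> L * dist a b + onorm ((*v) A) * (G * norm (z t - xs t)) * dist (a - t) (b - t)"
        using ab st by (intro add_mono lipschitz_onD[OF L] lipschitz_onD[OF Ly]) auto
      finally show "dist (w a) (w b) \<le> (L + onorm ((*v) A) * (G * norm (z t - xs t))) * dist a b"
        by (simp add: dist_norm algebra_simps)
    qed (use pos \<open>L \<ge> 0\<close> \<open>G \<ge> 1\<close> in simp)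
    define x where "x r = (if r \<le> s then xs r else if r \<le> t then z r else w r)" for r
    have adm_lip: "\<exists>K. K-lipschitz_on {0..T} x"
    proof -
      have "(max (onorm F * E) (L + onorm ((*v) A) * (G * norm (z t - xs t))))-lipschitz_on {s..T}
          (\<lambda>r. if r \<le> t then z r else w r)"
        using st by (intro lipschitz_on_concat_max[OF lipschitz_on_subset[OF Lz] Lw]) (auto simp: w_def y0)
      from lipschitz_on_concat_max[OF lipschitz_on_subset[OF L, of "{0..s}"] this]
      show ?thesis using st zs by (auto simp: x_def[abs_def])
    qed
    have "admissible A B V T xbar x (\<lambda>r. if r \<in> {s..t} then v else us r)"
      unfolding admissible_def
    proof (intro conjI)
      have "us \<in> borel_measurable (lebesgue_on {0..T})" using adm by (simp add: admissible_def)
      then show "(\<lambda>r. if r \<in> {s..t} then v else us r) \<in> borel_measurable (lebesgue_on {0..T})"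
        by (intro measurable_If_set) (auto simp: sets_restrict_space)
      show "\<forall>r\<in>{0..T}. (if r \<in> {s..t} then v else us r) \<in> V"
        using adm \<open>v \<in> V\<close> by (simp add: admissible_def)
      show "absolutely_continuous_fun 0 T x"
        using adm_lip lipschitz_imp_absolutely_continuous by blast
      show "x 0 = xbar" using adm st by (simp add: x_def admissible_def)
      show "AE r in lebesgue_on {0..T}.
        (x has_vector_derivative (A *v x r + B *v (if r \<in> {s..t} then v else us r))) (at r within {0..T})"
        unfolding AE_lebesgue_on_interval_iff
        \<comment> \<open>at the two gluing times the derivative need not exist\<close>
      proof (intro exI[of _ "N \<union> {s, t}"] conjI ballI)
        show "negligible (N \<union> {s, t})" using \<open>negligible N\<close> by simp
        fix r assume r: "r \<in> {0..T} - (N \<union> {s, t})"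
        consider "r < s" | "s < r" "r < t" | "t < r" using r by force
        then show "(x has_vector_derivative (A *v x r + B *v (if r \<in> {s..t} then v else us r))) (at r within {0..T})"
        proof cases
          case 1
          have "(x has_vector_derivative (A *v xs r + B *v us r)) (at r within {0..T})"
            using r 1 by (intro has_vector_derivative_transform_within[OF N[rule_format], of r "s - r"])
              (auto simp: x_def dist_real_def)
          then show ?thesis using 1 by (simp add: x_def)
        next
          case 2
          have "(x has_vector_derivative (A *v z r + B *v v)) (at r within {0..T})"
            using r 2 by (intro has_vector_derivative_transform_within[OF has_vector_derivative_at_within[OF z],
                  of "min (r - s) (t - r)"]) (auto simp: x_def dist_real_def)
          then show ?thesis using 2 by (simp add: x_def)
        next
          case 3
          have "(x has_vector_derivative (A *v w r + B *v us r)) (at r within {0..T})"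
            using r 3 st by (intro has_vector_derivative_transform_within[OF w, of r "r - t"])
              (auto simp: x_def dist_real_def)
          then show ?thesis using 3 st by (simp add: x_def)
        qed
      qed
    qed
    moreover have "norm (x r - xs r) \<le> G * D * (t - s)" if r: "r \<in> {0..T}" for r
    proof -
      have zx: "norm (z r - xs r) \<le> D * (t - s)" if "s \<le> r" "r \<le> t" for r
      proof -
        have "norm (z r - xs r) \<le> norm (z r - z s) + norm (xs r - xs s)"
          using norm_triangle_ineq4[of "z r - z s" "xs r - xs s"] zs by simp
        also have "\<dots> \<le> onorm F * E * norm (r - s) + L * norm (r - s)"
          using that st by (intro add_mono lipschitz_on_normD[OF Lz] lipschitz_on_normD[OF L]) auto
        also have "\<dots> = D * (r - s)" using that by (simp add: D_def algebra_simps)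
        also have "\<dots> \<le> D * (t - s)" using that \<open>D \<ge> 0\<close> by (intro mult_left_mono) auto
        finally show ?thesis .
      qed
      have le: "D * (t - s) \<le> G * (D * (t - s))"
        using \<open>G \<ge> 1\<close> \<open>D \<ge> 0\<close> st mult_right_mono[of 1 G "D * (t - s)"] by simp
      consider "r \<le> s" | "s < r" "r \<le> t" | "t < r" by linarith
      then show ?thesis
      proof cases
        case 1
        then show ?thesis using st \<open>D \<ge> 0\<close> \<open>G \<ge> 1\<close> by (simp add: x_def)
      next
        case 2
        then show ?thesis using zx[of r] le by (simp add: x_def mult.assoc)
      next
        case 3
        then have "norm (x r - xs r) \<le> G * norm (z t - xs t)"
          using r st ybound'[of "r - t"] by (simp add: x_def w_def)
        also have "\<dots> \<le> G * (D * (t - s))"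
          using zx[of t] st \<open>G \<ge> 1\<close> by (intro mult_left_mono) auto
        finally show ?thesis by (simp add: mult.assoc)
      qed
    qed
    ultimately show "\<exists>x. admissible A B V T xbar x (\<lambda>r. if r \<in> {s..t} then v else us r) \<and>
      (\<forall>r\<in>{0..T}. norm (x r - xs r) \<le> G * D * (t - s))" by blast
  qed
qed

section \<open>The maximum condition\<close>

text \<open>
For a needle of length \<open>h = t - s\<close> the cost changes by exactly \<open>\<integral> g\<close> over the needle plus the quadratic
term \<open>\<delta> \<bullet> Q \<delta> / 2\<close> in the end point displacement \<open>\<delta>\<close>, which is of order \<open>h\<^sup>2\<close>. Here \<open>g\<close> is the
difference of the Hamiltonians of \<open>us\<close> and of \<open>v\<close>. As needles are close to \<open>xs\<close> in the supremum
norm, minimality bounds \<open>\<integral> g\<close> from below by a multiple of \<open>-h\<^sup>2\<close>.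
\<close>

lemma maximum_condition_at_point:
  fixes A Q :: "real ^ 'd ^ 'd" and B :: "real ^ 'm ^ 'd" and L :: "real ^ 'm \<Rightarrow> real"
  assumes "T > 0" "bounded V"
    and L_meas: "L \<in> borel_measurable borel" and L_bound: "\<And>v. v \<in> V \<Longrightarrow> \<bar>L v\<bar> \<le> c"
    and Q_sym: "transpose Q = Q"
    and min: "local_minimizer A B V T xbar
      (\<lambda>x u. - integral\<^sup>L (lebesgue_on {0..T}) (\<lambda>t. L (u t))
        + 1 / 2 * ((x T - xhat) \<bullet> (Q *v (x T - xhat)))) xs us"
    and p: "\<And>t. (p has_vector_derivative - (transpose A *v p t)) (at t)"
    and pT: "p T = - (Q *v (xs T - xhat))"
    and "v \<in> V"
  shows "AE t in lebesgue_on {0..T}. p t \<bullet> (B *v v) + L v \<le> p t \<bullet> (B *v us t) + L (us t)"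
proof -
  define J where "J x u = - integral\<^sup>L (lebesgue_on {0..T}) (\<lambda>t. L (u t))
        + 1 / 2 * ((x T - xhat) \<bullet> (Q *v (x T - xhat)))" for x u
  from min have adm: "admissible A B V T xbar xs us"
    by (simp add: local_minimizer_def)
  from min obtain \<epsilon> where "\<epsilon> > 0"
    and \<epsilon>: "\<forall>x u. admissible A B V T xbar x u \<and> (SUP t\<in>{0..T}. norm (x t - xs t)) \<le> \<epsilon>
      \<longrightarrow> J xs us \<le> J x u"
    unfolding local_minimizer_def J_def by blast
  obtain C where "C \<ge> 0" and C: "\<forall>s t. 0 \<le> s \<longrightarrow> s \<le> t \<longrightarrow> t \<le> T \<longrightarrow>
    (\<exists>x. admissible A B V T xbar x (\<lambda>r. if r \<in> {s..t} then v else us r) \<and>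
      (\<forall>r\<in>{0..T}. norm (x r - xs r) \<le> C * (t - s)))"
    using needle_trajectory[OF adm \<open>bounded V\<close> \<open>v \<in> V\<close>] by blast
  have L_int: "((\<lambda>t. L (u t)) has_integral integral\<^sup>L (lebesgue_on {0..T}) (\<lambda>t. L (u t))) {0..T}"
    if u: "admissible A B V T xbar x u" for x u
  proof -
    have "integrable (lebesgue_on {0..T}) (\<lambda>t. L (u t))"
    proof (rule finite_measure.integrable_const_bound[of _ _ c])
      show "finite_measure (lebesgue_on {0..T})" by (intro finite_measure_lebesgue_on) auto
      show "AE t in lebesgue_on {0..T}. norm (L (u t)) \<le> c"
        using u L_bound by (intro AE_I2) (auto simp: admissible_def)
      show "(\<lambda>t. L (u t)) \<in> borel_measurable (lebesgue_on {0..T})"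
        using u L_meas by (auto simp: admissible_def intro: measurable_compose)
    qed
    then show ?thesis
      by (rule has_integral_integral_lebesgue_on) auto
  qed
  define H where "H t w = p t \<bullet> (B *v w) + L w" for t w
  have H_int: "((\<lambda>t. H t (u t)) has_integral
      (p T \<bullet> x T - p 0 \<bullet> xbar + integral\<^sup>L (lebesgue_on {0..T}) (\<lambda>t. L (u t)))) {0..T}"
    if u: "admissible A B V T xbar x u" for x u
    using has_integral_add[OF adjoint_pairing_has_integral[OF u \<open>bounded V\<close> p, of 0 T] L_int[OF u]]
      \<open>T > 0\<close> u by (simp add: H_def admissible_def)
  define g where "g t = H t (us t) - H t v" for t
  have "g integrable_on {0..T}"
    unfolding g_def
  proof (rule integrable_diff)
    show "(\<lambda>t. H t (us t)) integrable_on {0..T}" using H_int[OF adm] by blast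
    have "continuous_on {0..T} p"
      by (intro continuous_at_imp_continuous_on ballI has_vector_derivative_continuous[OF p])
    then show "(\<lambda>t. H t v) integrable_on {0..T}"
      unfolding H_def by (intro integrable_continuous_real continuous_intros)
  qed
  moreover have "integral {s..t} g \<ge> - (onorm ((*v) Q) * C\<^sup>2 / 2) * (t - s)\<^sup>2"
    if st: "0 \<le> s" "s \<le> t" "t \<le> T" "t - s \<le> \<epsilon> / (C + 1)" for s t
  proof -
    let ?u = "\<lambda>r. if r \<in> {s..t} then v else us r"
    obtain x where x: "admissible A B V T xbar x ?u"
      and close: "\<forall>r\<in>{0..T}. norm (x r - xs r) \<le> C * (t - s)"
      using C st(1-3) by blast
    have "C * (t - s) \<le> (C + 1) * (\<epsilon> / (C + 1))"
      using st \<open>C \<ge> 0\<close> by (intro mult_mono) auto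
    then have "C * (t - s) \<le> \<epsilon>" using \<open>C \<ge> 0\<close> by simp
    then have "(SUP t\<in>{0..T}. norm (x t - xs t)) \<le> \<epsilon>"
      using close \<open>T > 0\<close> by (intro cSUP_least) force+
    with x \<epsilon> have J: "J xs us \<le> J x ?u" by blast
    define \<delta> where "\<delta> = x T - xs T"
    define a where "a = xs T - xhat"
    have "norm \<delta> \<le> C * (t - s)" using close \<open>T > 0\<close> by (simp add: \<delta>_def)
    have xT: "x T - xhat = a + \<delta>" by (simp add: a_def \<delta>_def)
    have sym: "a \<bullet> (Q *v \<delta>) = \<delta> \<bullet> (Q *v a)"
      by (metis Q_sym dot_lmul_matrix inner_commute transpose_matrix_vector)
    have quad: "(x T - xhat) \<bullet> (Q *v (x T - xhat)) = a \<bullet> (Q *v a) + 2 * (\<delta> \<bullet> (Q *v a)) + \<delta> \<bullet> (Q *v \<delta>)"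
      unfolding xT by (simp add: matrix_vector_right_distrib inner_add_left inner_add_right sym)
    have "((\<lambda>r. H r (us r) - H r (?u r)) has_integral
      (p T \<bullet> xs T - p 0 \<bullet> xbar + integral\<^sup>L (lebesgue_on {0..T}) (\<lambda>t. L (us t)))
      - (p T \<bullet> x T - p 0 \<bullet> xbar + integral\<^sup>L (lebesgue_on {0..T}) (\<lambda>t. L (?u t)))) {0..T}"
      by (intro has_integral_diff H_int[OF adm] H_int[OF x])
    moreover have "(\<lambda>r. H r (us r) - H r (?u r)) = (\<lambda>r. if r \<in> {s..t} then g r else 0)"
      by (auto simp: g_def)
    ultimately have "(g has_integral
      (p T \<bullet> xs T - p 0 \<bullet> xbar + integral\<^sup>L (lebesgue_on {0..T}) (\<lambda>t. L (us t)))
      - (p T \<bullet> x T - p 0 \<bullet> xbar + integral\<^sup>L (lebesgue_on {0..T}) (\<lambda>t. L (?u t)))) {s..t}"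
      using st has_integral_restrict[of "{s..t}" "{0..T}" g] by simp
    then have "integral {s..t} g = - (p T \<bullet> \<delta>)
      + integral\<^sup>L (lebesgue_on {0..T}) (\<lambda>t. L (us t)) - integral\<^sup>L (lebesgue_on {0..T}) (\<lambda>t. L (?u t))"
      by (simp add: integral_unique \<delta>_def inner_diff_right)
    also have "p T \<bullet> \<delta> = - (\<delta> \<bullet> (Q *v a))"
      by (simp add: pT a_def inner_commute)
    finally have "integral {s..t} g \<ge> - (1 / 2 * (\<delta> \<bullet> (Q *v \<delta>)))"
      using J unfolding J_def quad a_def[symmetric] by (simp add: add_divide_distrib)
    moreover have "\<delta> \<bullet> (Q *v \<delta>) \<le> onorm ((*v) Q) * C\<^sup>2 * (t - s)\<^sup>2"
    proof -
      have "\<delta> \<bullet> (Q *v \<delta>) \<le> norm \<delta> * (onorm ((*v) Q) * norm \<delta>)"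
        by (intro order_trans[OF norm_cauchy_schwarz] mult_left_mono onorm matrix_vector_mul_bounded_linear) auto
      also have "\<dots> = onorm ((*v) Q) * (norm \<delta>)\<^sup>2" by (simp add: power2_eq_square)
      also have "\<dots> \<le> onorm ((*v) Q) * (C * (t - s))\<^sup>2"
        using \<open>norm \<delta> \<le> C * (t - s)\<close>
        by (intro mult_left_mono power_mono onorm_pos_le matrix_vector_mul_bounded_linear) auto
      finally show ?thesis by (simp add: power_mult_distrib mult.assoc)
    qed
    ultimately show ?thesis by simp
  qed
  moreover have "\<epsilon> / (C + 1) > 0" using \<open>\<epsilon> > 0\<close> \<open>C \<ge> 0\<close> by simp
  ultimately have "AE t in lebesgue_on {0..T}. g t \<ge> 0"
    by (intro AE_nonneg_if_integral_ge_quadratic[of g 0 T "\<epsilon> / (C + 1)"])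
  then show ?thesis by (simp add: g_def H_def)
qed

text \<open>
The exceptional null set depends on the control value. As \<open>L\<close> may be discontinuous, exchanging
quantifiers needs a countable set that approximates each value at constant \<open>L\<close>.
\<close>

lemma maximum_condition:
  fixes A Q :: "real ^ 'd ^ 'd" and B :: "real ^ 'm ^ 'd" and L :: "real ^ 'm \<Rightarrow> real"
  assumes "T > 0" "bounded V"
    and "L \<in> borel_measurable borel" and "\<And>v. v \<in> V \<Longrightarrow> \<bar>L v\<bar> \<le> c"
    and "transpose Q = Q"
    and "local_minimizer A B V T xbar
      (\<lambda>x u. - integral\<^sup>L (lebesgue_on {0..T}) (\<lambda>t. L (u t))
        + 1 / 2 * ((x T - xhat) \<bullet> (Q *v (x T - xhat)))) xs us"
    and "\<And>t. (p has_vector_derivative - (transpose A *v p t)) (at t)"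
    and "p T = - (Q *v (xs T - xhat))"
    and "countable D" "D \<subseteq> V"
    and dense: "\<And>v. v \<in> V \<Longrightarrow> v \<in> closure {w \<in> D. L w = L v}"
  shows "AE t in lebesgue_on {0..T}. \<forall>v\<in>V. p t \<bullet> (B *v v) + L v \<le> p t \<bullet> (B *v us t) + L (us t)"
proof -
  have "AE t in lebesgue_on {0..T}. \<forall>v\<in>D. p t \<bullet> (B *v v) + L v \<le> p t \<bullet> (B *v us t) + L (us t)"
    using \<open>D \<subseteq> V\<close> by (subst AE_ball_countable[OF \<open>countable D\<close>])
      (auto intro!: maximum_condition_at_point[OF assms(1-8)])
  then show ?thesis
  proof eventually_elim
    case (elim t)
    show ?case
    proof
      fix v assume "v \<in> V"
      obtain w where w: "\<And>n. w n \<in> {w \<in> D. L w = L v}" "w \<longlonglongrightarrow> v"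
        using dense[OF \<open>v \<in> V\<close>] unfolding closure_sequential by blast
      have "(\<lambda>n. p t \<bullet> (B *v w n) + L v) \<longlonglongrightarrow> p t \<bullet> (B *v v) + L v"
        by (intro tendsto_intros w bounded_linear.tendsto[OF matrix_vector_mul_bounded_linear])
      moreover have "p t \<bullet> (B *v w n) + L v \<le> p t \<bullet> (B *v us t) + L (us t)" for n
        using elim w(1)[of n] by auto
      ultimately show "p t \<bullet> (B *v v) + L v \<le> p t \<bullet> (B *v us t) + L (us t)"
        by (intro LIMSEQ_le_const2) auto
    qed
  qed
qed

section \<open>Constancy of the Hamiltonian\<close>

text \<open>
Let \<open>m t\<close> be the maximum over \<open>v\<close> of \<open>p t \<bullet> B v + L v\<close>. At almost every \<open>t\<close> it is attained at
\<open>us t\<close>, so \<open>m (s + h) - m s \<ge> (p (s + h) - p s) \<bullet> B (us s)\<close> for \<^emph>\<open>both\<close> signs of \<open>h\<close>, and the right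
side is \<open>- h (q s \<bullet> B (us s))\<close> up to \<open>O(h\<^sup>2)\<close>, where \<open>q = A\<^sup>T p\<close>. Integrating over \<open>[0, t]\<close> removes the
need for \<open>m\<close> to be differentiable: with \<open>M\<close> an antiderivative of \<open>m\<close>, the differentiable function
\<open>h \<mapsto> M (t + h) - M h - (M t - M 0) + h r + D h\<^sup>2 t\<close> has a minimum at \<open>h = 0\<close>, and its derivative there
is \<open>m t - m 0 + r\<close>. Since \<open>q\<close> also solves the adjoint equation, \<open>r = \<integral> q \<bullet> B us\<close> is the increment
of \<open>q \<bullet> xs\<close>, and \<open>m + q \<bullet> xs\<close> is the Hamiltonian.
\<close>

lemma hamiltonian_constant:
  fixes A :: "real ^ 'd ^ 'd" and B :: "real ^ 'm ^ 'd" and L :: "real ^ 'm \<Rightarrow> real"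
  assumes "T > 0" "bounded V"
    and adm: "admissible A B V T xbar xs us"
    and L_bound: "\<And>v. v \<in> V \<Longrightarrow> \<bar>L v\<bar> \<le> c"
    and p: "\<And>t. (p has_vector_derivative - (transpose A *v p t)) (at t)"
    and max: "AE t in lebesgue_on {0..T}. \<forall>v\<in>V. p t \<bullet> (B *v v) + L v \<le> p t \<bullet> (B *v us t) + L (us t)"
  shows "\<exists>K. AE t in lebesgue_on {0..T}. p t \<bullet> (A *v xs t + B *v us t) + L (us t) = K"
proof -
  have us: "us t \<in> V" if "t \<in> {0..T}" for t
    using adm that by (simp add: admissible_def)
  then have "V \<noteq> {}" using \<open>T > 0\<close> by force
  have "bounded ((\<lambda>v. B *v v) ` V)"
    by (intro bounded_linear_image[OF \<open>bounded V\<close>] matrix_vector_mul_bounded_linear)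
  then obtain R where "R > 0" and R: "\<And>v. v \<in> V \<Longrightarrow> norm (B *v v) \<le> R"
    unfolding bounded_pos by blast
  have pair_le: "y \<bullet> (B *v v) \<le> norm y * R" if "v \<in> V" for y v
    using norm_cauchy_schwarz[of y "B *v v"] mult_left_mono[OF R[OF that], of "norm y"] by simp
  define m where "m t = (SUP v\<in>V. p t \<bullet> (B *v v) + L v)" for t
  have bdd: "bdd_above ((\<lambda>v. p t \<bullet> (B *v v) + L v) ` V)" for t
    using pair_le L_bound by (intro bdd_aboveI2[of _ _ "norm (p t) * R + c"]) (force intro: add_mono)
  have m_ge: "p t \<bullet> (B *v v) + L v \<le> m t" if "v \<in> V" for t v
    unfolding m_def by (rule cSUP_upper[OF that bdd])
  have m_diff: "m s - m t \<le> norm (p s - p t) * R" for s t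
  proof -
    have "p s \<bullet> (B *v v) + L v \<le> m t + norm (p s - p t) * R" if "v \<in> V" for v
      using m_ge[OF that, of t] pair_le[OF that, of "p s - p t"] by (simp add: inner_diff_left)
    then have "m s \<le> m t + norm (p s - p t) * R"
      unfolding m_def[of s] by (intro cSUP_least \<open>V \<noteq> {}\<close>)
    then show ?thesis by simp
  qed
  have p_cont: "isCont p t" for t
    by (rule has_vector_derivative_continuous[OF p])
  have m_cont: "isCont m t" for t
  proof -
    have "((\<lambda>s. norm (p s - p t) * R) \<longlongrightarrow> norm (p t - p t) * R) (at t)"
      using p_cont[of t] by (intro tendsto_intros) (simp add: isCont_def)
    then have "((\<lambda>s. norm (p s - p t) * R) \<longlongrightarrow> 0) (at t)" by simp
    moreover have "norm (m s - m t) \<le> norm (p s - p t) * R" for s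
      using m_diff[of s t] m_diff[of t s] by (simp add: norm_minus_commute abs_le_iff)
    ultimately have "((\<lambda>s. m s - m t) \<longlongrightarrow> 0) (at t)"
      by (intro Lim_null_comparison[of "\<lambda>s. m s - m t"] always_eventually) auto
    then show ?thesis by (simp add: isCont_def LIM_zero_iff)
  qed
  obtain N where "negligible N"
    and N: "\<forall>t\<in>{0..T} - N. \<forall>v\<in>V. p t \<bullet> (B *v v) + L v \<le> p t \<bullet> (B *v us t) + L (us t)"
    using max unfolding AE_lebesgue_on_interval_iff by blast
  have m_eq: "m t = p t \<bullet> (B *v us t) + L (us t)" if "t \<in> {0..T} - N" for t
    unfolding m_def using N that us by (intro cSup_eq_maximum) auto
  define q where "q t = transpose A *v p t" for t
  have q: "(q has_vector_derivative - (transpose A *v q t)) (at t)" for t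
    using bounded_linear.has_vector_derivative[OF matrix_vector_mul_bounded_linear p[of t], of "transpose A"]
    by (simp only: q_def[abs_def] linear_neg[OF matrix_vector_mul_linear])
  have linA: "linear (\<lambda>y. - (transpose A *v y))"
    by (intro linear_compose_neg matrix_vector_mul_linear)
  have lower: "\<exists>D. \<forall>t\<in>{0..T} - N. \<forall>h. \<bar>h\<bar> < 1 \<longrightarrow> - h * (q t \<bullet> (B *v us t)) - D * h\<^sup>2 \<le> m (t + h) - m t"
  proof -
    have "bounded (q ` {-1..T+1})"
      by (intro compact_imp_bounded compact_continuous_image continuous_at_imp_continuous_on ballI
          has_vector_derivative_continuous[OF q]) auto
    then obtain M where "M > 0" and M: "\<forall>t\<in>{-1..T+1}. norm (q t) \<le> M"
      unfolding bounded_pos by auto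
    define K where "K = onorm (\<lambda>y. - (transpose A *v y)) * M"
    have Kq: "K-lipschitz_on {-1..T+1} q"
      unfolding K_def using M \<open>M > 0\<close> by (intro linear_flow_lipschitz[OF linA q]) auto
    have "K \<ge> 0" using Kq lipschitz_on_nonneg by blast
    have "- h * (q t \<bullet> (B *v us t)) - K * R * h\<^sup>2 \<le> m (t + h) - m t"
      if t: "t \<in> {0..T} - N" and h: "\<bar>h\<bar> < 1" for t h
    proof -
      have ut: "us t \<in> V" using us t by simp
      have seg: "r \<in> {-1..T+1} \<and> \<bar>r - t\<bar> \<le> \<bar>h\<bar>" if "r \<in> closed_segment t (t + h)" for r
        using that t h by (auto simp: closed_segment_eq_real_ivl split: if_splits)
      have "norm (p (t + h) - p t - (t + h - t) *\<^sub>R (- q t)) \<le> norm (t + h - t) * (K * \<bar>h\<bar>)"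
      proof (rule vector_differentiable_bound_linearization[where S = "closed_segment t (t + h)"])
        fix r assume r: "r \<in> closed_segment t (t + h)"
        show "(p has_vector_derivative - q r) (at r within closed_segment t (t + h))"
          unfolding q_def by (rule has_vector_derivative_at_within[OF p])
        have "norm (- q r - - q t) = norm (q r - q t)" by (simp add: norm_minus_commute)
        also have "\<dots> \<le> K * norm (r - t)"
          using seg[OF r] t by (intro lipschitz_on_normD[OF Kq]) auto
        also have "\<dots> \<le> K * \<bar>h\<bar>"
          using seg[OF r] \<open>K \<ge> 0\<close> by (intro mult_left_mono) auto
        finally show "norm (- q r - - q t) \<le> K * \<bar>h\<bar>" .
      qed auto
      then have "norm (p (t + h) - p t + h *\<^sub>R q t) \<le> K * h\<^sup>2"
        by (simp add: power2_eq_square mult_ac flip: abs_mult)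
      then have "norm (p (t + h) - p t + h *\<^sub>R q t) * R \<le> K * h\<^sup>2 * R"
        using \<open>R > 0\<close> by (intro mult_right_mono) auto
      moreover have "- ((p (t + h) - p t + h *\<^sub>R q t) \<bullet> (B *v us t)) \<le> norm (p (t + h) - p t + h *\<^sub>R q t) * R"
        using pair_le[OF ut, of "- (p (t + h) - p t + h *\<^sub>R q t)"] by (metis inner_minus_left norm_minus_cancel)
      moreover have "m (t + h) - m t \<ge> (p (t + h) - p t) \<bullet> (B *v us t)"
        using m_ge[OF ut, of "t + h"] m_eq[OF t] by (simp add: inner_diff_left)
      ultimately show ?thesis
        by (simp add: inner_add_left mult_ac)
    qed
    then show ?thesis by blast
  qed
  then obtain D where D: "\<forall>t\<in>{0..T} - N. \<forall>h. \<bar>h\<bar> < 1 \<longrightarrow>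
      - h * (q t \<bullet> (B *v us t)) - D * h\<^sup>2 \<le> m (t + h) - m t" by blast
  have const: "m t + q t \<bullet> xs t = m 0 + q 0 \<bullet> xs 0" if t: "t \<in> {0..T}" for t
  proof -
    \<comment> \<open>the lower limit leaves room for shifts by \<open>\<bar>h\<bar> < 1\<close> to the left of \<open>0\<close>\<close>
    define M where "M s = integral {-2..s} m" for s
    have M: "(M has_real_derivative m s) (at s)" if "s \<in> {-1..T+1}" for s
    proof -
      have "(M has_real_derivative m s) (at s within {-2..T+2})"
        unfolding M_def using that
        by (intro integral_has_real_derivative continuous_at_imp_continuous_on ballI m_cont) auto
      moreover have "at s within {-2..T+2} = at s"
        using that by (intro at_within_interior) auto
      ultimately show ?thesis by simp
    qed
    define W where "W h = M (t + h) - M h - (M t - M 0)" for h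
    define r where "r = q t \<bullet> xs t - q 0 \<bullet> xs 0"
    have qint: "((\<lambda>s. q s \<bullet> (B *v us s)) has_integral r) {0..t}"
      unfolding r_def using t by (intro adjoint_pairing_has_integral[OF adm \<open>bounded V\<close> q]) auto
    have W_ge: "W h + h * r + D * h\<^sup>2 * t \<ge> 0" if h: "\<bar>h\<bar> < 1" for h
    proof -
      have upper_int: "((\<lambda>s. m (s + h) - m s) has_integral ((M (t + h) - M t) - (M (0 + h) - M 0))) {0..t}"
      proof (intro fundamental_theorem_of_calculus)
        fix s assume s: "s \<in> {0..t}"
        have "((\<lambda>s. M (s + h)) has_real_derivative m (s + h)) (at s)"
          using s t h DERIV_shift[of M "m (s + h)" s h] M[of "s + h"] by (simp add: abs_less_iff)
        then have "((\<lambda>s. M (s + h) - M s) has_real_derivative m (s + h) - m s) (at s)"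
          using s t by (intro DERIV_diff M) auto
        then show "((\<lambda>s. M (s + h) - M s) has_vector_derivative m (s + h) - m s) (at s within {0..t})"
          by (simp add: has_real_derivative_iff_has_vector_derivative has_vector_derivative_at_within)
      qed (use t in auto)
      have "((\<lambda>s. - h * (q s \<bullet> (B *v us s)) - D * h\<^sup>2) has_integral (- h * r - D * h\<^sup>2 * t)) {0..t}"
        using has_integral_diff[OF has_integral_mult_right[OF qint, of "- h"] has_integral_const_real[of "D * h\<^sup>2" 0 t]] t
        by (simp add: mult_ac)
      \<comment> \<open>the integrand is altered on \<open>N\<close>, where the lower bound may fail\<close>
      then have lower_int: "((\<lambda>s. if s \<in> N then m (s + h) - m s else - h * (q s \<bullet> (B *v us s)) - D * h\<^sup>2)
          has_integral (- h * r - D * h\<^sup>2 * t)) {0..t}"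
        by (rule has_integral_spike[OF \<open>negligible N\<close>, rotated]) auto
      have "- h * r - D * h\<^sup>2 * t \<le> (M (t + h) - M t) - (M (0 + h) - M 0)"
      proof (rule has_integral_le[OF lower_int upper_int])
        fix s assume "s \<in> {0..t}"
        then show "(if s \<in> N then m (s + h) - m s else - h * (q s \<bullet> (B *v us s)) - D * h\<^sup>2) \<le> m (s + h) - m s"
          using D[rule_format, of s h] t h by auto
      qed
      then show ?thesis by (simp add: W_def algebra_simps)
    qed
    have "((\<lambda>h. W h + h * r + D * h\<^sup>2 * t) has_real_derivative (m t - m 0 + r)) (at 0)"
    proof -
      have "((\<lambda>h. M (t + h)) has_real_derivative m t) (at 0)"
        using DERIV_shift[of M "m t" 0 t] M[of t] t by (simp add: add.commute)
      moreover have "(M has_real_derivative m 0) (at 0)" using M[of 0] \<open>T > 0\<close> by simp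
      ultimately show ?thesis
        unfolding W_def by (auto intro!: derivative_eq_intros)
    qed
    then have "m t - m 0 + r = 0"
      by (rule DERIV_local_min[where d = 1]) (use W_ge in \<open>auto simp: W_def\<close>)
    then show ?thesis by (simp add: r_def)
  qed
  have "p t \<bullet> (A *v xs t + B *v us t) + L (us t) = m 0 + q 0 \<bullet> xs 0" if t: "t \<in> {0..T} - N" for t
  proof -
    have "p t \<bullet> (A *v xs t + B *v us t) + L (us t) = m t + q t \<bullet> xs t"
      by (simp add: m_eq[OF t] q_def inner_add_right dot_lmul_matrix)
    also have "\<dots> = m 0 + q 0 \<bullet> xs 0" using t by (intro const) auto
    finally show ?thesis .
  qed
  then show ?thesis
    unfolding AE_lebesgue_on_interval_iff using \<open>negligible N\<close>
    by (intro exI[of _ "m 0 + q 0 \<bullet> xs 0"] exI[of _ N] conjI ballI)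
qed

section \<open>Block structure of the controls\<close>

lemma block_eq_if_block_space:
  assumes "v \<in> block_space \<gamma> k"
  shows "block \<gamma> l v = (if l = k then v else 0)"
  using assms by (auto simp: block_def block_space_def vec_eq_iff)

lemma U_M_eq_UNION:
  assumes "\<And>k. U k \<subseteq> block_space \<gamma> k"
  shows "U_M \<gamma> U = (\<Union>k. U k)"
proof (intro equalityI subsetI)
  fix u assume "u \<in> U_M \<gamma> U"
  then obtain k where k: "block \<gamma> k u \<in> U k" "\<And>l. l \<noteq> k \<Longrightarrow> block \<gamma> l u = 0"
    by (auto simp: U_M_def)
  have "block \<gamma> k u = u"
  proof (subst vec_eq_iff, rule allI)
    fix i
    show "block \<gamma> k u $ i = u $ i"
    proof (cases "\<gamma> i = k")
      case False
      have "u $ i = block \<gamma> (\<gamma> i) u $ i" by (simp add: block_def)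
      also have "\<dots> = 0" by (simp add: k(2)[OF False])
      finally show ?thesis using False by (simp add: block_def)
    qed (simp add: block_def)
  qed
  with k(1) show "u \<in> (\<Union>k. U k)" by auto
next
  fix u assume "u \<in> (\<Union>k. U k)"
  then obtain k where k: "u \<in> U k" "u \<in> block_space \<gamma> k" using assms by blast
  then show "u \<in> U_M \<gamma> U"
    unfolding U_M_def by (intro UN_I[of k]) (auto simp: block_eq_if_block_space[OF k(2)])
qed

text \<open>
A control supported in block \<open>k\<close> acts through \<open>Bk k\<close> only, so the Hamiltonian splits into one
function per block.
\<close>

lemma inner_blkdiag_mult:
  fixes \<beta> :: "'d::finite \<Rightarrow> 'n" and \<gamma> :: "'m::finite \<Rightarrow> 'n"
  assumes Bk: "Bk k \<in> block_matrices \<beta> \<gamma> k" and v: "v \<in> block_space \<gamma> k"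
  shows "p \<bullet> (blkdiag \<beta> \<gamma> Bk *v v) = (transpose (Bk k) *v block \<beta> k p) \<bullet> v"
proof -
  have entry: "(if \<beta> i = \<gamma> j then Bk (\<beta> i) $ i $ j else 0) * v $ j = Bk k $ i $ j * v $ j" for i j
    using Bk v by (cases "\<gamma> j = k") (auto simp: block_matrices_def block_space_def)
  then have eq: "blkdiag \<beta> \<gamma> Bk *v v = Bk k *v v"
    by (simp only: blkdiag_def matrix_vector_mult_def vec_lambda_beta entry)
  have "(Bk k *v v) $ i = 0" if "\<beta> i \<noteq> k" for i
    using Bk that by (simp add: block_matrices_def matrix_vector_mult_def)
  then have "p \<bullet> (Bk k *v v) = block \<beta> k p \<bullet> (Bk k *v v)"
    unfolding inner_vec_def block_def by (intro sum.cong) auto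
  then show ?thesis by (simp add: eq dot_lmul_matrix)
qed

lemma transpose_blkdiag:
  assumes "\<And>k. transpose (Qk k) = Qk k"
  shows "transpose (blkdiag \<beta> \<beta> Qk) = blkdiag \<beta> \<beta> Qk"
proof -
  have "Qk k $ j $ i = Qk k $ i $ j" for k i j
  proof -
    have "Qk k $ j $ i = transpose (Qk k) $ i $ j" by (simp add: transpose_def)
    then show ?thesis by (simp only: assms)
  qed
  then show ?thesis by (auto simp: blkdiag_def transpose_def vec_eq_iff)
qed

lemma sum_indicator_block:
  fixes lam :: "'n::finite \<Rightarrow> real"
  assumes "v \<in> block_space \<gamma> k"
  shows "(\<Sum>l\<in>UNIV. lam l * indicator {0} (block \<gamma> l v)) = lam k * indicator {0} v + (\<Sum>l\<in>UNIV - {k}. lam l)"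
proof -
  have "(\<Sum>l\<in>UNIV. lam l * indicator {0} (block \<gamma> l v))
      = lam k * indicator {0} (block \<gamma> k v) + (\<Sum>l\<in>UNIV - {k}. lam l * indicator {0} (block \<gamma> l v))"
    by (rule sum.remove) auto
  also have "(\<Sum>l\<in>UNIV - {k}. lam l * indicator {0} (block \<gamma> l v)) = (\<Sum>l\<in>UNIV - {k}. lam l)"
    by (intro sum.cong) (auto simp: block_eq_if_block_space[OF assms])
  finally show ?thesis by (simp add: block_eq_if_block_space[OF assms])
qed

lemma block_measurable: "block \<gamma> k \<in> borel_measurable borel"
proof -
  have "linear (block \<gamma> k)"
    by (rule linearI) (auto simp: block_def vec_eq_iff)
  then show ?thesis
    by (intro borel_measurable_continuous_onI linear_continuous_on) (simp add: linear_conv_bounded_linear)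
qed

text \<open>
The activity reward is constant on each \<open>U k - {0}\<close>, so a countable dense subset of each of these
sets, together with \<open>0\<close>, approximates every control value without changing the reward.
\<close>

lemma countable_dense_constant_indicator:
  fixes U :: "'n::finite \<Rightarrow> (real ^ 'm) set"
  assumes sub: "\<And>k. U k \<subseteq> block_space \<gamma> k" and zero: "\<And>k. 0 \<in> U k"
  obtains D where "countable D" "D \<subseteq> (\<Union>k. U k)"
    "\<And>v. v \<in> (\<Union>k. U k) \<Longrightarrow> v \<in> closure {w \<in> D.
      (\<Sum>k\<in>UNIV. lam k * indicator {0} (block \<gamma> k w)) = (\<Sum>k\<in>UNIV. lam k * indicator {0} (block \<gamma> k v) :: real)}"
proof -
  have "\<forall>k. \<exists>T. countable T \<and> T \<subseteq> U k - {0} \<and> U k - {0} \<subseteq> closure T"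
  proof
    fix k
    obtain T where "countable T" "T \<subseteq> U k - {0}" "U k - {0} \<subseteq> closure T"
      by (rule separable)
    then show "\<exists>T. countable T \<and> T \<subseteq> U k - {0} \<and> U k - {0} \<subseteq> closure T" by blast
  qed
  from choice[OF this] obtain T where "\<forall>k. countable (T k) \<and> T k \<subseteq> U k - {0} \<and> U k - {0} \<subseteq> closure (T k)"
    by blast
  then have T: "countable (T k)" "T k \<subseteq> U k - {0}" "U k - {0} \<subseteq> closure (T k)" for k by auto
  let ?D = "insert 0 (\<Union>k. T k)"
  show thesis
  proof (rule that[of ?D])
    show "countable ?D" using T(1) by auto
    show "?D \<subseteq> (\<Union>k. U k)" using T(2) zero by blast
    fix v assume "v \<in> (\<Union>k. U k)"
    then obtain k where v: "v \<in> U k" by blast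
    let ?S = "{w \<in> ?D. (\<Sum>k\<in>UNIV. lam k * indicator {0} (block \<gamma> k w))
      = (\<Sum>k\<in>UNIV. lam k * indicator {0} (block \<gamma> k v))}"
    show "v \<in> closure ?S"
    proof (cases "v = 0")
      case True
      then show ?thesis using closure_subset[of ?S] by auto
    next
      case False
      have "T k \<subseteq> ?S"
      proof
        fix w assume w: "w \<in> T k"
        then have "w \<in> U k" "w \<noteq> 0" using T(2) by auto
        then have wv: "w \<in> block_space \<gamma> k" "v \<in> block_space \<gamma> k" using sub v by auto
        have "(\<Sum>k\<in>UNIV. lam k * indicator {0} (block \<gamma> k w)) = (\<Sum>k\<in>UNIV. lam k * indicator {0} (block \<gamma> k v))"
          unfolding sum_indicator_block[OF wv(1)] sum_indicator_block[OF wv(2)]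
          using \<open>w \<noteq> 0\<close> False by simp
        then show "w \<in> ?S" using w by blast
      qed
      then have "closure (T k) \<subseteq> closure ?S" by (rule closure_mono)
      then show ?thesis using T(3)[of k] v False by blast
    qed
  qed
qed

text \<open>
On \<open>U k\<close> the Hamiltonian is \<open>f k v = b\<^sub>k \<bullet> v + \<lambda>\<^sub>k 1\<^bsub>{0}\<^esub> v + \<lambda>'\<^sub>k\<close>, so a maximizer \<open>u \<in> U s\<close> over the
union shows that block \<open>s\<close> attains the largest of the block maxima. If \<open>u \<noteq> 0\<close>, then \<open>u\<close> maximizes
\<open>b\<^sub>s \<bullet> v\<close>, and comparison with \<open>v = 0\<close> gives \<open>\<lambda>\<^sub>s \<le> b\<^sub>s \<bullet> u\<close>. If \<open>u = 0\<close>, comparison with a maximizer of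
\<open>b\<^sub>s \<bullet> v\<close> gives \<open>max (b\<^sub>s \<bullet> v) \<le> \<lambda>\<^sub>s\<close>.
\<close>

lemma pointwise_maximizer_structure:
  fixes \<beta> :: "'d::finite \<Rightarrow> 'n::finite" and \<gamma> :: "'m::finite \<Rightarrow> 'n" and lam :: "'n \<Rightarrow> real"
  assumes Bk: "\<And>k. Bk k \<in> block_matrices \<beta> \<gamma> k"
    and sub: "\<And>k. U k \<subseteq> block_space \<gamma> k" and cpt: "\<And>k. compact (U k)" and zero: "\<And>k. 0 \<in> U k"
    and lam: "\<And>k. lam k > 0" and lam': "\<And>k. lam' k = (\<Sum>l\<in>UNIV - {k}. lam l)"
    and u: "u \<in> U s"
    and max: "\<And>v. v \<in> (\<Union>k. U k) \<Longrightarrow>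
      p \<bullet> (blkdiag \<beta> \<gamma> Bk *v v) + (\<Sum>k\<in>UNIV. lam k * indicator {0} (block \<gamma> k v))
      \<le> p \<bullet> (blkdiag \<beta> \<gamma> Bk *v u) + (\<Sum>k\<in>UNIV. lam k * indicator {0} (block \<gamma> k u))"
  shows "(k \<noteq> s \<longrightarrow> block \<gamma> k u = 0) \<and>
            (k = s \<longrightarrow>
               block \<gamma> k u \<in>
                 (let b = transpose (Bk k) *v block \<beta> k p;
                      M = (SUP v\<in>U k. b \<bullet> v)
                  in if M > lam k then argmax (\<lambda>v. b \<bullet> v) (U k)
                     else if M = lam k then {0} \<union> argmax (\<lambda>v. b \<bullet> v) (U k)
                     else {0}))"
    and "s \<in> argmax (\<lambda>k. SUP v\<in>U k. (transpose (Bk k) *v block \<beta> k p) \<bullet> v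
                                      + lam k * indicator {0} v + lam' k) UNIV"
proof -
  define b where "b k = transpose (Bk k) *v block \<beta> k p" for k
  define f where "f k v = b k \<bullet> v + lam k * indicator {0} v + lam' k" for k v
  have f: "p \<bullet> (blkdiag \<beta> \<gamma> Bk *v v) + (\<Sum>k\<in>UNIV. lam k * indicator {0} (block \<gamma> k v)) = f k v"
    if "v \<in> U k" for k v
  proof -
    have "v \<in> block_space \<gamma> k" using sub that by blast
    then show ?thesis
      by (simp only: f_def b_def lam' inner_blkdiag_mult[OF Bk] sum_indicator_block add.assoc)
  qed
  have le: "f k v \<le> f s u" if "v \<in> U k" for k v
    using max[of v] f[OF that] f[OF u] that by auto
  have block_u: "block \<gamma> k u = (if k = s then u else 0)" for k
    using sub u by (intro block_eq_if_block_space) auto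
  define M where "M = (SUP v\<in>U s. b s \<bullet> v)"
  obtain w where w: "w \<in> U s" "M = b s \<bullet> w"
    using SUP_inner_attained[OF cpt[of s] zero[of s], of "b s"] unfolding M_def by blast
  have "u \<in> (if M > lam s then argmax (\<lambda>v. b s \<bullet> v) (U s)
      else if M = lam s then {0} \<union> argmax (\<lambda>v. b s \<bullet> v) (U s) else {0})"
  proof (cases "u = 0")
    case True
    have "M \<le> lam s"
    proof (cases "w = 0")
      case False
      then show ?thesis using le[OF w(1)] w(2) True by (simp add: f_def)
    qed (use w lam[of s] in simp)
    with True show ?thesis by simp
  next
    case False
    have *: "b s \<bullet> v \<le> b s \<bullet> u" if "v \<in> U s" for v
    proof -
      have "0 \<le> lam s * indicator {0} v" using lam[of s] by (simp add: indicator_def)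
      then show ?thesis using le[OF that] False by (simp add: f_def)
    qed
    then have "u \<in> argmax (\<lambda>v. b s \<bullet> v) (U s)"
      using u by (auto simp: argmax_def is_arg_max_def not_less)
    moreover have "M = b s \<bullet> u" using * w u unfolding M_def by (intro cSup_eq_maximum) auto
    moreover have "lam s \<le> b s \<bullet> u" using le[OF zero[of s]] False by (simp add: f_def)
    ultimately show ?thesis by auto
  qed
  then show "(k \<noteq> s \<longrightarrow> block \<gamma> k u = 0) \<and>
            (k = s \<longrightarrow>
               block \<gamma> k u \<in>
                 (let b = transpose (Bk k) *v block \<beta> k p;
                      M = (SUP v\<in>U k. b \<bullet> v)
                  in if M > lam k then argmax (\<lambda>v. b \<bullet> v) (U k)
                     else if M = lam k then {0} \<union> argmax (\<lambda>v. b \<bullet> v) (U k)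
                     else {0}))"
    unfolding Let_def block_u b_def M_def by auto
  have "(SUP v\<in>U k. f k v) \<le> f s u" for k
    using zero[of k] le by (intro cSUP_least) auto
  moreover have "(SUP v\<in>U s. f s v) = f s u"
    using u le by (intro cSup_eq_maximum) auto
  ultimately show "s \<in> argmax (\<lambda>k. SUP v\<in>U k. (transpose (Bk k) *v block \<beta> k p) \<bullet> v
                                      + lam k * indicator {0} v + lam' k) UNIV"
    by (simp add: argmax_def is_arg_max_def not_less f_def b_def)
qed

theorem theorem5p2:
  fixes \<beta> :: "'d::finite \<Rightarrow> 'n::finite"
    and \<gamma> :: "'m::finite \<Rightarrow> 'n"
    and T :: real
    and Ak :: "'n \<Rightarrow> real ^ 'd ^ 'd"
    and Bk :: "'n \<Rightarrow> real ^ 'm ^ 'd"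
    and Qk :: "'n \<Rightarrow> real ^ 'd ^ 'd"
    and U :: "'n \<Rightarrow> (real ^ 'm) set"
    and lam lam' :: "'n \<Rightarrow> real"
    and xbar xhat :: "real ^ 'd"
    and A Q :: "real ^ 'd ^ 'd"
    and B :: "real ^ 'm ^ 'd"
    and xs :: "real \<Rightarrow> real ^ 'd"
    and us :: "real \<Rightarrow> real ^ 'm"
  assumes "T > 0"
    and "\<And>k. Ak k \<in> block_matrices \<beta> \<beta> k"
    and "\<And>k. Bk k \<in> block_matrices \<beta> \<gamma> k"
    and "\<And>k. U k \<subseteq> block_space \<gamma> k"
    and "\<And>k. compact (U k)"
    and "\<And>k. 0 \<in> U k"
    and "\<And>k. Qk k \<in> block_matrices \<beta> \<beta> k"
    and "\<And>k. transpose (Qk k) = Qk k"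
    and "\<And>k v. v \<in> block_space \<beta> k \<Longrightarrow> 0 \<le> v \<bullet> (Qk k *v v)"
    and "\<And>k. lam k > 0"
    and "A = blkdiag \<beta> \<beta> Ak"
    and "B = blkdiag \<beta> \<gamma> Bk"
    and "Q = blkdiag \<beta> \<beta> Qk"
    and "\<And>k. lam' k = (\<Sum>l\<in>UNIV - {k}. lam l)"
    and "local_minimizer A B (U_M \<gamma> U) T xbar (cost \<gamma> lam Q xhat T) xs us"
  shows "\<exists>(p :: real \<Rightarrow> real ^ 'd) (\<sigma> :: real \<Rightarrow> 'n).
    absolutely_continuous_fun 0 T p \<and>
    \<sigma> \<in> measurable (lebesgue_on {0..T}) (count_space UNIV) \<and>
    xs 0 = xbar \<and>
    p T = - (Q *v (xs T - xhat)) \<and>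
    (AE t in lebesgue_on {0..T}.
       (xs has_vector_derivative (A *v xs t + B *v us t)) (at t within {0..T}) \<and>
       (p has_vector_derivative - (transpose A *v p t)) (at t within {0..T}) \<and>
       (\<forall>k. (k \<noteq> \<sigma> t \<longrightarrow> block \<gamma> k (us t) = 0) \<and>
            (k = \<sigma> t \<longrightarrow>
               block \<gamma> k (us t) \<in>
                 (let b = transpose (Bk k) *v block \<beta> k (p t);
                      M = (SUP v\<in>U k. b \<bullet> v)
                  in if M > lam k then argmax (\<lambda>v. b \<bullet> v) (U k)
                     else if M = lam k then {0} \<union> argmax (\<lambda>v. b \<bullet> v) (U k)
                     else {0}))) \<and>
       \<sigma> t \<in> argmax (\<lambda>k. SUP v\<in>U k. (transpose (Bk k) *v block \<beta> k (p t)) \<bullet> v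
                                      + lam k * indicator {0} v + lam' k) UNIV) \<and>
    (\<exists>c. AE t in lebesgue_on {0..T}.
       p t \<bullet> (A *v xs t + B *v us t) + (\<Sum>k\<in>UNIV. lam k * indicator {0} (block \<gamma> k (us t))) = c)"
proof -
  define V where "V = (\<Union>k. U k)"
  have V: "U_M \<gamma> U = V" unfolding V_def by (rule U_M_eq_UNION) (rule assms(4))
  define L where "L v = (\<Sum>k\<in>UNIV. lam k * indicator {0} (block \<gamma> k v))" for v
  have "bounded V"
    unfolding V_def by (intro bounded_UN ballI compact_imp_bounded assms(5)) simp
  have L_meas: "L \<in> borel_measurable borel"
    unfolding L_def
    by (intro borel_measurable_sum borel_measurable_times borel_measurable_const
        measurable_compose[OF block_measurable] borel_measurable_indicator) auto
  have L_bound: "\<bar>L v\<bar> \<le> (\<Sum>k\<in>UNIV. lam k)" for v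
  proof -
    have "\<bar>L v\<bar> \<le> (\<Sum>k\<in>UNIV. \<bar>lam k * indicator {0} (block \<gamma> k v)\<bar>)"
      unfolding L_def by (rule sum_abs)
    also have "\<dots> \<le> (\<Sum>k\<in>UNIV. lam k)"
      using assms(10) by (intro sum_mono) (auto simp: indicator_def less_imp_le)
    finally show ?thesis .
  qed
  have Q_sym: "transpose Q = Q"
    unfolding assms(13) by (rule transpose_blkdiag) (rule assms(8))
  have min: "local_minimizer A B V T xbar
      (\<lambda>x u. - integral\<^sup>L (lebesgue_on {0..T}) (\<lambda>t. L (u t))
        + 1 / 2 * ((x T - xhat) \<bullet> (Q *v (x T - xhat)))) xs us"
    using assms(15) unfolding V cost_def[abs_def] L_def .
  then have adm: "admissible A B V T xbar xs us"
    by (simp add: local_minimizer_def)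
  have linA: "linear (\<lambda>y. - (transpose A *v y))"
    by (intro linear_compose_neg matrix_vector_mul_linear)
  obtain y where y: "y 0 = - (Q *v (xs T - xhat))" "\<And>t. (y has_vector_derivative - (transpose A *v y t)) (at t)"
    using linear_ode_solution[OF linA] by metis
  define p where "p t = y (t - T)" for t
  have pT: "p T = - (Q *v (xs T - xhat))" by (simp add: p_def y)
  have p: "(p has_vector_derivative - (transpose A *v p t)) (at t)" for t
    unfolding p_def by (rule has_vector_derivative_shift[OF y(2)])
  have "bounded (p ` {0..T})"
    by (intro compact_imp_bounded compact_continuous_image continuous_at_imp_continuous_on ballI
        has_vector_derivative_continuous[OF p]) auto
  then obtain M where "M > 0" "\<forall>t\<in>{0..T}. norm (p t) \<le> M"
    unfolding bounded_pos by auto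
  then have "(onorm (\<lambda>y. - (transpose A *v y)) * M)-lipschitz_on {0..T} p"
    by (intro linear_flow_lipschitz[OF linA p]) auto
  then have p_ac: "absolutely_continuous_fun 0 T p"
    by (rule lipschitz_imp_absolutely_continuous)
  obtain D where D: "countable D" "D \<subseteq> V" "\<And>v. v \<in> V \<Longrightarrow> v \<in> closure {w \<in> D. L w = L v}"
    unfolding V_def L_def
    by (rule countable_dense_constant_indicator[of U \<gamma> lam]) (use assms(4,6) in blast)+
  have max: "AE t in lebesgue_on {0..T}. \<forall>v\<in>V. p t \<bullet> (B *v v) + L v \<le> p t \<bullet> (B *v us t) + L (us t)"
    by (rule maximum_condition[OF assms(1) \<open>bounded V\<close> L_meas L_bound Q_sym min p pT D])
  \<comment> \<open>the active block; a fixed arbitrary one at times when the control vanishes\<close>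
  define \<sigma> where "\<sigma> t = (SOME k. block \<gamma> k (us t) \<noteq> 0)" for t
  have us: "us t \<in> V" if "t \<in> {0..T}" for t using adm that by (simp add: admissible_def)
  have us_block: "\<exists>l. us t \<in> U l \<and> (\<forall>k. block \<gamma> k (us t) = (if k = l then us t else 0))"
    if t: "t \<in> {0..T}" for t
  proof -
    obtain l where l: "us t \<in> U l" using us[OF t] by (auto simp: V_def)
    then have "us t \<in> block_space \<gamma> l" using assms(4) by blast
    with l show ?thesis
      by (intro exI[of _ l] conjI allI block_eq_if_block_space)
  qed
  have \<sigma>_eq: "\<sigma> t = k \<longleftrightarrow> block \<gamma> k (us t) \<noteq> 0"
    if t: "t \<in> {0..T}" and nz: "block \<gamma> l (us t) \<noteq> 0" for t k l
  proof -
    obtain j where j: "\<forall>k. block \<gamma> k (us t) = (if k = j then us t else 0)"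
      using us_block[OF t] by blast
    with nz have "us t \<noteq> 0" by (auto split: if_splits)
    with j have "block \<gamma> k (us t) \<noteq> 0 \<longleftrightarrow> k = j" for k by simp
    then show ?thesis by (auto simp: \<sigma>_def)
  qed
  have us_\<sigma>: "us t \<in> U (\<sigma> t)" if t: "t \<in> {0..T}" for t
  proof -
    obtain j where j: "us t \<in> U j" "\<forall>k. block \<gamma> k (us t) = (if k = j then us t else 0)"
      using us_block[OF t] by blast
    show ?thesis
    proof (cases "us t = 0")
      case True
      then show ?thesis using assms(6) by simp
    next
      case False
      then have "\<sigma> t = j" using \<sigma>_eq[OF t, of j j] j(2) by simp
      then show ?thesis using j(1) by simp
    qed
  qed
  have \<sigma>_meas: "\<sigma> \<in> measurable (lebesgue_on {0..T}) (count_space UNIV)"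
  proof -
    let ?M = "lebesgue_on {0..T}"
    have "us \<in> borel_measurable ?M" using adm by (simp add: admissible_def)
    then have bm: "(\<lambda>t. block \<gamma> k (us t)) \<in> borel_measurable ?M" for k
      by (rule measurable_compose[OF _ block_measurable])
    have nz: "{t \<in> space ?M. block \<gamma> k (us t) \<noteq> 0} \<in> sets ?M" for k
      using measurable_sets[OF bm[of k], of "- {0}"] by (simp add: vimage_def Int_def conj_commute)
    let ?Z = "space ?M - (\<Union>l. {t \<in> space ?M. block \<gamma> l (us t) \<noteq> 0})"
    have Z: "?Z \<in> sets ?M" using nz by (intro sets.Diff sets.top sets.finite_UN) auto
    have "\<sigma> -` {k} \<inter> space ?M \<in> sets ?M" for k
    proof -
      have "\<sigma> -` {k} \<inter> space ?M
          = {t \<in> space ?M. block \<gamma> k (us t) \<noteq> 0} \<union> (if k = (SOME l. False) then ?Z else {})"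
      proof (rule set_eqI)
        fix t
        show "t \<in> \<sigma> -` {k} \<inter> space ?M \<longleftrightarrow>
          t \<in> {t \<in> space ?M. block \<gamma> k (us t) \<noteq> 0} \<union> (if k = (SOME l. False) then ?Z else {})"
        proof (cases "t \<in> space ?M \<and> (\<exists>l. block \<gamma> l (us t) \<noteq> 0)")
          case True
          then obtain l where "t \<in> {0..T}" "block \<gamma> l (us t) \<noteq> 0" by auto
          from \<sigma>_eq[OF this, of k] True show ?thesis by auto
        next
          case False
          show ?thesis
          proof (cases "t \<in> space ?M")
            case True
            with False have zero: "block \<gamma> l (us t) = 0" for l by blast
            then have "\<sigma> t = (SOME l. False)" by (simp add: \<sigma>_def)
            with zero True show ?thesis by auto
          qed auto
        qed
      qed
      then show ?thesis using nz Z by auto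
    qed
    then show ?thesis by (simp add: measurable_count_space_eq2)
  qed
  have "AE t in lebesgue_on {0..T}.
        (xs has_vector_derivative (A *v xs t + B *v us t)) (at t within {0..T})"
    using adm by (simp add: admissible_def)
  moreover have "AE t in lebesgue_on {0..T}. t \<in> {0..T}"
    by (rule AE_I2) simp
  ultimately have main: "AE t in lebesgue_on {0..T}.
       (xs has_vector_derivative (A *v xs t + B *v us t)) (at t within {0..T}) \<and>
       (p has_vector_derivative - (transpose A *v p t)) (at t within {0..T}) \<and>
       (\<forall>k. (k \<noteq> \<sigma> t \<longrightarrow> block \<gamma> k (us t) = 0) \<and>
            (k = \<sigma> t \<longrightarrow>
               block \<gamma> k (us t) \<in>
                 (let b = transpose (Bk k) *v block \<beta> k (p t);
                      M = (SUP v\<in>U k. b \<bullet> v)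
                  in if M > lam k then argmax (\<lambda>v. b \<bullet> v) (U k)
                     else if M = lam k then {0} \<union> argmax (\<lambda>v. b \<bullet> v) (U k)
                     else {0}))) \<and>
       \<sigma> t \<in> argmax (\<lambda>k. SUP v\<in>U k. (transpose (Bk k) *v block \<beta> k (p t)) \<bullet> v
                                      + lam k * indicator {0} v + lam' k) UNIV"
    using max
  proof eventually_elim
    case (elim t)
    have opt: "p t \<bullet> (blkdiag \<beta> \<gamma> Bk *v v) + (\<Sum>k\<in>UNIV. lam k * indicator {0} (block \<gamma> k v))
      \<le> p t \<bullet> (blkdiag \<beta> \<gamma> Bk *v us t) + (\<Sum>k\<in>UNIV. lam k * indicator {0} (block \<gamma> k (us t)))"
      if "v \<in> (\<Union>k. U k)" for v
      using elim(3) that unfolding V_def L_def assms(12) by blast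
    note maximizer = pointwise_maximizer_structure[OF assms(3-6) assms(10) assms(14) us_\<sigma>[OF elim(2)] opt]
    show ?case
      by (intro conjI allI elim(1) has_vector_derivative_at_within[OF p] maximizer(1) maximizer(2))
  qed
  have const: "\<exists>c. AE t in lebesgue_on {0..T}.
      p t \<bullet> (A *v xs t + B *v us t) + (\<Sum>k\<in>UNIV. lam k * indicator {0} (block \<gamma> k (us t))) = c"
    using hamiltonian_constant[OF assms(1) \<open>bounded V\<close> adm L_bound p max] unfolding L_def .
  have "xs 0 = xbar" using adm by (simp add: admissible_def)
  show ?thesis
    by (intro exI[of _ p] exI[of _ \<sigma>] conjI p_ac \<sigma>_meas \<open>xs 0 = xbar\<close> pT main const)
qed

end
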